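(* Let $\Sigma$ be a signature. The categories $\mathbf{MAlg}(\Sigma)$ of $\Sigma$-multialgebras and $\mathbf{Alg}_{\mathsf{B}}(\Sigma)$ of $(\Sigma,\leq)$-algebras are equivalent, an equivalence being given by the functors $\mathbb{P}:\mathbf{MAlg}(\Sigma)\to\mathbf{Alg}_{\mathsf{B}}(\Sigma)$ and $\mathbb{A}:\mathbf{Alg}_{\mathsf{B}}(\Sigma)\to\mathbf{MAlg}(\Sigma)$ (that is, $\mathbb{A}\circ\mathbb{P}$ and $\mathbb{P}\circ\mathbb{A}$ are naturally isomorphic to the respective identity functors).
   Context: A signature is a family $\Sigma=\{\Sigma_n\}_{n\in\mathbb{N}}$ of pairwise disjoint, possibly empty sets; elements of $\Sigma_n$ are $n$-ary symbols, and $\Sigma$ also denotes the union of the $\Sigma_n$. Write $\mathcal{P}^*(A)=\mathcal{P}(A)\setminus\{\emptyset\}$. A $\Sigma$-multialgebra is a pair $\mathcal{A}=(A,\{\sigma_{\mathcal{A}}\}_{\sigma\in\Sigma})$ with $A$ a non-empty set and $\sigma_{\mathcal{A}}:A^n\to\mathcal{P}^*(A)$ for $\sigma\in\Sigma_n$. A homomorphism $h:\mathcal{A}\to\mathcal{B}$ of $\Sigma$-multialgebras is a function $h:A\to B$ with $\{h(a):a\in\sigma_{\mathcal{A}}(a_1,\ldots,a_n)\}\subseteq\sigma_{\mathcal{B}}(h(a_1),\ldots,h(a_n))$ for all $n$, $\sigma\in\Sigma_n$, $a_1,\ldots,a_n\in A$. $\mathbf{MAlg}(\Sigma)$ is the category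 of $\Sigma$-multialgebras and these homomorphisms. For a non-empty poset $(A,\leq)$, let $(A,\leq)_0$ be the poset on $A\cup\{0\}$ (with $0\notin A$) obtained by adjoining $0$ as a new least element. $(A,\leq)$ is a complete, atomic and bottomless Boolean algebra if $(A,\leq)_0$ is a complete, atomic Boolean algebra (with $0\neq 1$), where atomic means every element is the supremum of the atoms below it. The atoms of $(A,\leq)$ are its minimal elements, and $A_a$ denotes the set of atoms less than or equal to $a$. A $(\Sigma,\leq)$-algebra is a triple $\mathcal{A}=(A,\{\sigma_{\mathcal{A}}\}_{\sigma\in\Sigma},\leq_{\mathcal{A}})$ such that $(A,\{\sigma_{\mathcal{A}}\})$ is a $\Sigma$-algebra (each $\sigma\in\Sigma_n$ is interpreted by a function $A^n\to A$), $(A,\leq_{\mathcal{A}})$ is a complete, atomic and bottomless Boolean algebra, and $\sigma_{\mathcal{A}}(a_1,\ldots,a_n)=\sup\{\sigma_{\mathcal{A}}(b_1,\ldots,b_n):(b_1,\ldots,b_n)\in A_{a_1}\times\cdots\times A_{a_n}\}$ for all $\sigma\in\Sigma_n$, $a_1,\ldots,a_n\in A$. A $(\Sigma,\leq)$-homomorphism $h:\mathcal{A}\to\mathcal{B}$ is a function $h:A\to B$ such that (1) $h(\sigma_{\mathcal{A}}(a_1,\ldots,a_n))\leq_{\mathcal{B}}\sigma_{\mathcal{B}}(h(a_1),\ldots,h(a_n))$ for all $\sigma\in\Sigma_n$ and $a_i\in A$; (2) $h(\sup A')=\sup\{h(a):a\in A'\}$ for every non-empty $A'\subseteq A$; (3)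 $h$ maps minimal elements to minimal elements. $\mathbf{Alg}_{\mathsf{B}}(\Sigma)$ is the category of $(\Sigma,\leq)$-algebras and $(\Sigma,\leq)$-homomorphisms. The functor $\mathbb{P}$: $\mathbb{P}(\mathcal{A})$ has universe $\mathcal{P}^*(A)$, order given by inclusion, and operations $\sigma_{\mathbb{P}(\mathcal{A})}(A_1,\ldots,A_n)=\bigcup\{\sigma_{\mathcal{A}}(a_1,\ldots,a_n):a_i\in A_i\}$; for a homomorphism $h:\mathcal{A}\to\mathcal{B}$, $\mathbb{P}(h)(A')=\{h(a):a\in A'\}$. The functor $\mathbb{A}$: $\mathbb{A}(\mathcal{A})$ has as universe the set of atoms of $(A,\leq_{\mathcal{A}})$ and multioperations $\sigma_{\mathbb{A}(\mathcal{A})}(a_1,\ldots,a_n)=A_{\sigma_{\mathcal{A}}(a_1,\ldots,a_n)}$ for atoms $a_1,\ldots,a_n$; for a $(\Sigma,\leq)$-homomorphism $h$, $\mathbb{A}(h)$ is the restriction of $h$ to atoms. *)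

theory Defs
  imports
    "HOL-Algebra.Complete_Lattice"
    "HOL-Library.FuncSet"
    "HOL-Library.Disjoint_Sets"
    "HOL-Library.Equipollence"
begin

section \<open>Categories, functors, equivalences\<close>

text \<open>Arrows do not record their source and target: arrows with different sources or targets may
  be represented by the same value, so identities, composition and the arrow part of a functor take
  the objects involved as arguments.\<close>

record ('o, 'm) cat =
  Obj :: "'o set"
  Hom :: "'o \<Rightarrow> 'o \<Rightarrow> 'm set"
  Ident :: "'o \<Rightarrow> 'm"
  Comp :: "'o \<Rightarrow> 'o \<Rightarrow> 'o \<Rightarrow> 'm \<Rightarrow> 'm \<Rightarrow> 'm"

definition category :: "('o, 'm) cat \<Rightarrow> bool" where
  "category C \<longleftrightarrow>
     (\<forall>X\<in>Obj C. Ident C X \<in> Hom C X X) \<and>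
     (\<forall>X\<in>Obj C. \<forall>Y\<in>Obj C. \<forall>Z\<in>Obj C. \<forall>f\<in>Hom C X Y. \<forall>g\<in>Hom C Y Z.
        Comp C X Y Z g f \<in> Hom C X Z) \<and>
     (\<forall>X\<in>Obj C. \<forall>Y\<in>Obj C. \<forall>f\<in>Hom C X Y.
        Comp C X X Y f (Ident C X) = f \<and> Comp C X Y Y (Ident C Y) f = f) \<and>
     (\<forall>W\<in>Obj C. \<forall>X\<in>Obj C. \<forall>Y\<in>Obj C. \<forall>Z\<in>Obj C.
        \<forall>f\<in>Hom C W X. \<forall>g\<in>Hom C X Y. \<forall>h\<in>Hom C Y Z.
          Comp C W X Z (Comp C X Y Z h g) f = Comp C W Y Z h (Comp C W X Y g f))"

definition iso_in :: "('o, 'm) cat \<Rightarrow> 'o \<Rightarrow> 'o \<Rightarrow> 'm \<Rightarrow> bool" where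
  "iso_in C X Y f \<longleftrightarrow> f \<in> Hom C X Y \<and>
     (\<exists>g\<in>Hom C Y X. Comp C X Y X g f = Ident C X \<and> Comp C Y X Y f g = Ident C Y)"

definition full_subcategory :: "('o, 'm) cat \<Rightarrow> 'o set \<Rightarrow> ('o, 'm) cat" where
  "full_subcategory C O' = C\<lparr>Obj := Obj C \<inter> O'\<rparr>"

record ('o1, 'm1, 'o2, 'm2) ftor =
  fobj :: "'o1 \<Rightarrow> 'o2"
  farr :: "'o1 \<Rightarrow> 'o1 \<Rightarrow> 'm1 \<Rightarrow> 'm2"

definition is_functor :: "('o1, 'm1) cat \<Rightarrow> ('o2, 'm2) cat \<Rightarrow> ('o1, 'm1, 'o2, 'm2) ftor \<Rightarrow> bool" where
  "is_functor C D F \<longleftrightarrow> category C \<and> category D \<and>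
     (\<forall>X\<in>Obj C. fobj F X \<in> Obj D) \<and>
     (\<forall>X\<in>Obj C. \<forall>Y\<in>Obj C. \<forall>f\<in>Hom C X Y. farr F X Y f \<in> Hom D (fobj F X) (fobj F Y)) \<and>
     (\<forall>X\<in>Obj C. farr F X X (Ident C X) = Ident D (fobj F X)) \<and>
     (\<forall>X\<in>Obj C. \<forall>Y\<in>Obj C. \<forall>Z\<in>Obj C. \<forall>f\<in>Hom C X Y. \<forall>g\<in>Hom C Y Z.
        farr F X Z (Comp C X Y Z g f) =
        Comp D (fobj F X) (fobj F Y) (fobj F Z) (farr F Y Z g) (farr F X Y f))"

definition id_ftor :: "('o, 'm, 'o, 'm) ftor" where
  "id_ftor = \<lparr>fobj = (\<lambda>X. X), farr = (\<lambda>_ _ f. f)\<rparr>"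

definition comp_ftor ::
  "('o2, 'm2, 'o3, 'm3) ftor \<Rightarrow> ('o1, 'm1, 'o2, 'm2) ftor \<Rightarrow> ('o1, 'm1, 'o3, 'm3) ftor"
  (infixl \<open>\<circ>\<^sub>F\<close> 55) where
  "G \<circ>\<^sub>F F = \<lparr>fobj = (\<lambda>X. fobj G (fobj F X)),
             farr = (\<lambda>X Y f. farr G (fobj F X) (fobj F Y) (farr F X Y f))\<rparr>"

definition naturally_isomorphic ::
  "('o1, 'm1) cat \<Rightarrow> ('o2, 'm2) cat \<Rightarrow> ('o1, 'm1, 'o2, 'm2) ftor \<Rightarrow> ('o1, 'm1, 'o2, 'm2) ftor \<Rightarrow> bool"
  where
  "naturally_isomorphic C D F G \<longleftrightarrow> is_functor C D F \<and> is_functor C D G \<and>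
     (\<exists>\<eta>. (\<forall>X\<in>Obj C. iso_in D (fobj F X) (fobj G X) (\<eta> X)) \<and>
          (\<forall>X\<in>Obj C. \<forall>Y\<in>Obj C. \<forall>f\<in>Hom C X Y.
             Comp D (fobj F X) (fobj F Y) (fobj G Y) (\<eta> Y) (farr F X Y f) =
             Comp D (fobj F X) (fobj G X) (fobj G Y) (farr G X Y f) (\<eta> X)))"

definition equivalence_of_categories ::
  "('o1, 'm1) cat \<Rightarrow> ('o2, 'm2) cat \<Rightarrow> ('o1, 'm1, 'o2, 'm2) ftor \<Rightarrow> ('o2, 'm2, 'o1, 'm1) ftor \<Rightarrow> bool"
  where
  "equivalence_of_categories C D F G \<longleftrightarrow> is_functor C D F \<and> is_functor D C G \<and>
     naturally_isomorphic C C id_ftor (G \<circ>\<^sub>F F) \<and> naturally_isomorphic D D id_ftor (F \<circ>\<^sub>F G)"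

section \<open>Signatures and multialgebras\<close>

definition signature :: "(nat \<Rightarrow> 's set) \<Rightarrow> bool" where
  "signature S \<longleftrightarrow> disjoint_family S"

text \<open>An \<open>n\<close>-tuple is a list of length \<open>n\<close>, and the operations of an algebra are bundled into a
  single function on pairs (symbol, argument tuple). Operations and morphisms are extensional
  functions, so that equality of objects and of morphisms is the set-theoretic one.\<close>

definition op_dom :: "(nat \<Rightarrow> 's set) \<Rightarrow> 'a set \<Rightarrow> ('s \<times> 'a list) set" where
  "op_dom S A = {(\<sigma>, xs). \<sigma> \<in> S (length xs) \<and> set xs \<subseteq> A}"

definition Pow_ne :: "'a set \<Rightarrow> 'a set set" where
  "Pow_ne A = Pow A - {{}}"

record ('s, 'a) malg =
  mcarr :: "'a set"
  mop :: "'s \<times> 'a list \<Rightarrow> 'a set"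

definition multialgebra :: "(nat \<Rightarrow> 's set) \<Rightarrow> ('s, 'a) malg \<Rightarrow> bool" where
  "multialgebra S M \<longleftrightarrow> mcarr M \<noteq> {} \<and> mop M \<in> op_dom S (mcarr M) \<rightarrow>\<^sub>E Pow_ne (mcarr M)"

definition malg_hom :: "(nat \<Rightarrow> 's set) \<Rightarrow> ('s, 'a) malg \<Rightarrow> ('s, 'b) malg \<Rightarrow> ('a \<Rightarrow> 'b) set" where
  "malg_hom S M N = {h \<in> mcarr M \<rightarrow>\<^sub>E mcarr N.
     \<forall>(\<sigma>, xs)\<in>op_dom S (mcarr M). h ` mop M (\<sigma>, xs) \<subseteq> mop N (\<sigma>, map h xs)}"

definition MAlg :: "(nat \<Rightarrow> 's set) \<Rightarrow> (('s, 'a) malg, 'a \<Rightarrow> 'a) cat" where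
  "MAlg S = \<lparr>Obj = {M. multialgebra S M}, Hom = malg_hom S,
             Ident = (\<lambda>M. \<lambda>x\<in>mcarr M. x), Comp = (\<lambda>M _ _ g f. compose (mcarr M) g f)\<rparr>"

section \<open>Complete, atomic and bottomless Boolean algebras\<close>

definition lattice_atoms :: "('a, 'b) gorder_scheme \<Rightarrow> 'a set" where
  "lattice_atoms L = {a \<in> carrier L. a \<noteq> \<bottom>\<^bsub>L\<^esub> \<and> (\<forall>x\<in>carrier L. x \<sqsubseteq>\<^bsub>L\<^esub> a \<longrightarrow> x = \<bottom>\<^bsub>L\<^esub> \<or> x = a)}"

definition complete_atomic_boolean_algebra :: "('a, 'b) gorder_scheme \<Rightarrow> bool" where
  "complete_atomic_boolean_algebra L \<longleftrightarrow> complete_lattice L \<and>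
     (\<forall>x\<in>carrier L. \<forall>y\<in>carrier L. \<forall>z\<in>carrier L.
        x \<sqinter>\<^bsub>L\<^esub> (y \<squnion>\<^bsub>L\<^esub> z) = (x \<sqinter>\<^bsub>L\<^esub> y) \<squnion>\<^bsub>L\<^esub> (x \<sqinter>\<^bsub>L\<^esub> z)) \<and>
     (\<forall>x\<in>carrier L. \<exists>y\<in>carrier L. x \<sqinter>\<^bsub>L\<^esub> y = \<bottom>\<^bsub>L\<^esub> \<and> x \<squnion>\<^bsub>L\<^esub> y = \<top>\<^bsub>L\<^esub>) \<and>
     \<bottom>\<^bsub>L\<^esub> \<noteq> \<top>\<^bsub>L\<^esub> \<and>
     (\<forall>x\<in>carrier L. x = \<Squnion>\<^bsub>L\<^esub>{a \<in> lattice_atoms L. a \<sqsubseteq>\<^bsub>L\<^esub> x})"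

definition adjoin_bottom :: "'a gorder \<Rightarrow> 'a option gorder" where
  "adjoin_bottom L = \<lparr>carrier = insert None (Some ` carrier L), eq = (=),
     le = (\<lambda>x y. case x of None \<Rightarrow> True
                 | Some a \<Rightarrow> (case y of None \<Rightarrow> False | Some b \<Rightarrow> a \<sqsubseteq>\<^bsub>L\<^esub> b))\<rparr>"

definition bottomless_boolean_algebra :: "'a gorder \<Rightarrow> bool" where
  "bottomless_boolean_algebra L \<longleftrightarrow> partial_order L \<and> carrier L \<noteq> {} \<and>
     complete_atomic_boolean_algebra (adjoin_bottom L)"

definition minimals :: "('a, 'b) gorder_scheme \<Rightarrow> 'a set" where
  "minimals L = {a \<in> carrier L. \<forall>x\<in>carrier L. x \<sqsubseteq>\<^bsub>L\<^esub> a \<longrightarrow> x = a}"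

definition atoms_below :: "('a, 'b) gorder_scheme \<Rightarrow> 'a \<Rightarrow> 'a set" where
  "atoms_below L a = {x \<in> minimals L. x \<sqsubseteq>\<^bsub>L\<^esub> a}"

section \<open>Ordered algebras over a signature\<close>

record ('s, 'a) balg =
  bcarr :: "'a set"
  bop :: "'s \<times> 'a list \<Rightarrow> 'a"
  ble :: "'a rel"

definition ord_of :: "('s, 'a) balg \<Rightarrow> 'a gorder" where
  "ord_of B = \<lparr>carrier = bcarr B, eq = (=), le = (\<lambda>x y. (x, y) \<in> ble B)\<rparr>"

definition ordered_algebra :: "(nat \<Rightarrow> 's set) \<Rightarrow> ('s, 'a) balg \<Rightarrow> bool" where
  "ordered_algebra S B \<longleftrightarrow>
     bop B \<in> op_dom S (bcarr B) \<rightarrow>\<^sub>E bcarr B \<and>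
     ble B \<subseteq> bcarr B \<times> bcarr B \<and> bottomless_boolean_algebra (ord_of B) \<and>
     (\<forall>(\<sigma>, xs)\<in>op_dom S (bcarr B).
        bop B (\<sigma>, xs) =
        \<Squnion>\<^bsub>ord_of B\<^esub>{bop B (\<sigma>, ys) | ys. ys \<in> listset (map (atoms_below (ord_of B)) xs)})"

definition balg_hom :: "(nat \<Rightarrow> 's set) \<Rightarrow> ('s, 'a) balg \<Rightarrow> ('s, 'b) balg \<Rightarrow> ('a \<Rightarrow> 'b) set" where
  "balg_hom S A B = {h \<in> bcarr A \<rightarrow>\<^sub>E bcarr B.
     (\<forall>(\<sigma>, xs)\<in>op_dom S (bcarr A). h (bop A (\<sigma>, xs)) \<sqsubseteq>\<^bsub>ord_of B\<^esub> bop B (\<sigma>, map h xs)) \<and>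
     (\<forall>X. X \<subseteq> bcarr A \<and> X \<noteq> {} \<longrightarrow> h (\<Squnion>\<^bsub>ord_of A\<^esub>X) = \<Squnion>\<^bsub>ord_of B\<^esub>(h ` X)) \<and>
     h ` minimals (ord_of A) \<subseteq> minimals (ord_of B)}"

definition AlgB :: "(nat \<Rightarrow> 's set) \<Rightarrow> (('s, 'a) balg, 'a \<Rightarrow> 'a) cat" where
  "AlgB S = \<lparr>Obj = {B. ordered_algebra S B}, Hom = balg_hom S,
             Ident = (\<lambda>B. \<lambda>x\<in>bcarr B. x), Comp = (\<lambda>B _ _ g f. compose (bcarr B) g f)\<rparr>"

section \<open>The functors \<open>\<P>\<close> and \<open>\<A>\<close>\<close>

definition P_alg :: "(nat \<Rightarrow> 's set) \<Rightarrow> ('s, 'a) malg \<Rightarrow> ('s, 'a set) balg" where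
  "P_alg S M = \<lparr>bcarr = Pow_ne (mcarr M),
     bop = (\<lambda>(\<sigma>, Xs)\<in>op_dom S (Pow_ne (mcarr M)). \<Union>{mop M (\<sigma>, xs) | xs. xs \<in> listset Xs}),
     ble = {(X, Y). X \<in> Pow_ne (mcarr M) \<and> Y \<in> Pow_ne (mcarr M) \<and> X \<subseteq> Y}\<rparr>"

definition P_ftor ::
  "(nat \<Rightarrow> 's set) \<Rightarrow> (('s, 'a) malg, 'a \<Rightarrow> 'a, ('s, 'a set) balg, 'a set \<Rightarrow> 'a set) ftor" where
  "P_ftor S = \<lparr>fobj = P_alg S, farr = (\<lambda>M _ h. \<lambda>X\<in>Pow_ne (mcarr M). h ` X)\<rparr>"

definition A_malg :: "(nat \<Rightarrow> 's set) \<Rightarrow> ('s, 'a) balg \<Rightarrow> ('s, 'a) malg" where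
  "A_malg S B = \<lparr>mcarr = minimals (ord_of B),
     mop = (\<lambda>(\<sigma>, xs)\<in>op_dom S (minimals (ord_of B)). atoms_below (ord_of B) (bop B (\<sigma>, xs)))\<rparr>"

definition A_ftor ::
  "(nat \<Rightarrow> 's set) \<Rightarrow> (('s, 'a) balg, 'a \<Rightarrow> 'a, ('s, 'a) malg, 'a \<Rightarrow> 'a) ftor" where
  "A_ftor S = \<lparr>fobj = A_malg S, farr = (\<lambda>B _ h. restrict h (minimals (ord_of B)))\<rparr>"

section \<open>Natural isomorphism with the identity across types\<close>

text \<open>\<open>P_ftor\<close> leads from structures on subsets of \<open>'a\<close> to structures on subsets of \<open>'a set\<close>, so
  its composites with \<open>A_ftor\<close> change the type. Homomorphisms are polymorphic
  in both carrier types, and natural isomorphism with the identity is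
  \<open>naturally_isomorphic\<close> with such heterogeneous homomorphisms as components.\<close>

definition malg_iso :: "(nat \<Rightarrow> 's set) \<Rightarrow> ('s, 'a) malg \<Rightarrow> ('s, 'b) malg \<Rightarrow> ('a \<Rightarrow> 'b) \<Rightarrow> bool" where
  "malg_iso S M N f \<longleftrightarrow> f \<in> malg_hom S M N \<and>
     (\<exists>g\<in>malg_hom S N M. compose (mcarr M) g f = (\<lambda>x\<in>mcarr M. x) \<and>
                          compose (mcarr N) f g = (\<lambda>x\<in>mcarr N. x))"

definition balg_iso :: "(nat \<Rightarrow> 's set) \<Rightarrow> ('s, 'a) balg \<Rightarrow> ('s, 'b) balg \<Rightarrow> ('a \<Rightarrow> 'b) \<Rightarrow> bool" where
  "balg_iso S A B f \<longleftrightarrow> f \<in> balg_hom S A B \<and>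
     (\<exists>g\<in>balg_hom S B A. compose (bcarr A) g f = (\<lambda>x\<in>bcarr A. x) \<and>
                          compose (bcarr B) f g = (\<lambda>x\<in>bcarr B. x))"

definition malg_naturally_iso_to_id ::
  "(nat \<Rightarrow> 's set) \<Rightarrow> (('s, 'a) malg, 'a \<Rightarrow> 'a, ('s, 'b) malg, 'b \<Rightarrow> 'b) ftor \<Rightarrow> bool" where
  "malg_naturally_iso_to_id S F \<longleftrightarrow>
     (\<exists>\<eta>. (\<forall>M\<in>Obj (MAlg S). malg_iso S M (fobj F M) (\<eta> M)) \<and>
          (\<forall>M\<in>Obj (MAlg S). \<forall>N\<in>Obj (MAlg S). \<forall>h\<in>malg_hom S M N.
             compose (mcarr M) (\<eta> N) h = compose (mcarr M) (farr F M N h) (\<eta> M)))"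

definition balg_naturally_iso_to_id ::
  "(nat \<Rightarrow> 's set) \<Rightarrow> (('s, 'a) balg, 'a \<Rightarrow> 'a, ('s, 'b) balg, 'b \<Rightarrow> 'b) ftor \<Rightarrow> bool" where
  "balg_naturally_iso_to_id S F \<longleftrightarrow>
     (\<exists>\<eta>. (\<forall>A\<in>Obj (AlgB S). balg_iso S A (fobj F A) (\<eta> A)) \<and>
          (\<forall>A\<in>Obj (AlgB S). \<forall>B\<in>Obj (AlgB S). \<forall>h\<in>balg_hom S A B.
             compose (bcarr A) (\<eta> B) h = compose (bcarr A) (farr F A B h) (\<eta> A)))"

section \<open>Universes\<close>

text \<open>By Cantor's theorem no single type can hold \<open>\<P>*(A)\<close> for every set \<open>A\<close> of its elements. A
  universe is a type with a notion of small set, closed under passing to sets of no greater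
  cardinality, in which every small set is itself represented, via \<open>code\<close>, by an element. The
  set-theoretic universe, whose small subclasses are the sets and whose coding is the identity, has
  this form; within HOL,
  \<open>small_universe_exists\<close> gives, for every infinite type, a universe in which the sets of at most
  that cardinality are small.

  An ordered algebra is isomorphic to \<open>\<P>*\<close> of its set of atoms, so in a universe where small sets
  are closed under powersets its carrier is small iff its set of atoms is. In a universe lacking
  this closure the set of atoms is the one to be bounded.\<close>

definition small_universe :: "('u set \<Rightarrow> bool) \<Rightarrow> ('u set \<Rightarrow> 'u) \<Rightarrow> bool" where
  "small_universe small code \<longleftrightarrow>
     (\<forall>X Y. small X \<and> Y \<lesssim> X \<longrightarrow> small Y) \<and> inj_on code {X. small X}"

lemma small_universe_exists:
  assumes "infinite (UNIV :: 'a set)"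
  shows "\<exists>code. small_universe (\<lambda>X :: 'a set set. X \<lesssim> (UNIV :: 'a set)) code"
proof -
  obtain p :: "'a \<times> 'a \<Rightarrow> 'a" where p: "inj p"
    using card_of_Times_same_infinite[OF assms]
    unfolding card_of_ordIso[symmetric] bij_betw_def by auto
  obtain q :: "'a option \<Rightarrow> 'a" where q: "inj q"
  proof -
    have "(UNIV :: 'a option set) \<lesssim> (UNIV :: 'a set)"
    proof -
      have "(UNIV :: 'a option set) = insert None (range Some)" by (simp add: UNIV_option_conv)
      moreover have "range (Some :: 'a \<Rightarrow> 'a option) \<approx> (UNIV :: 'a set)"
        by (rule inj_on_image_eqpoll_self) simp
      moreover have "insert None (range (Some :: 'a \<Rightarrow> 'a option)) \<approx> range (Some :: 'a \<Rightarrow> 'a option)"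
        using assms by (intro infinite_insert_eqpoll) (simp add: finite_image_iff)
      ultimately show ?thesis using eqpoll_imp_lepoll eqpoll_trans by metis
    qed
    then show ?thesis using that unfolding lepoll_def by auto
  qed
  define e where "e X = (SOME f. inj_on f X \<and> f ` X \<subseteq> (UNIV :: 'a set))" for X :: "'a set set"
  have e: "inj_on (e X) X" if "X \<lesssim> (UNIV :: 'a set)" for X
    using someI_ex[OF that[unfolded lepoll_def]] by (simp add: e_def)
  define code where "code X = {p (e X x, q y) | x y. x \<in> X \<and> (y = None \<or> (\<exists>z\<in>x. y = Some z))}" for X
  have rec: "X = {x. \<exists>i. p (i, q None) \<in> code X \<and> x = {z. p (i, q (Some z)) \<in> code X}}"
    if "X \<lesssim> (UNIV :: 'a set)" for X
  proof -
    have 1: "p (i, q None) \<in> code X \<longleftrightarrow> (\<exists>x\<in>X. i = e X x)" for i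
      unfolding code_def using p q by (auto simp: inj_eq)
    have 2: "p (e X x, q (Some z)) \<in> code X \<longleftrightarrow> z \<in> x" if "x \<in> X" for x z
      unfolding code_def using p q e[OF \<open>X \<lesssim> UNIV\<close>] that by (auto simp: inj_eq inj_on_eq_iff)
    show ?thesis using 1 2 by auto
  qed
  have "inj_on code {X. X \<lesssim> (UNIV :: 'a set)}"
  proof (rule inj_onI)
    fix X Y :: "'a set set"
    assume X: "X \<in> {X. X \<lesssim> (UNIV :: 'a set)}" and Y: "Y \<in> {X. X \<lesssim> (UNIV :: 'a set)}"
      and eq: "code X = code Y"
    have "X = {x. \<exists>i. p (i, q None) \<in> code X \<and> x = {z. p (i, q (Some z)) \<in> code X}}"
      using X by (intro rec) simp
    also have "\<dots> = Y"
      unfolding eq using Y by (intro rec[symmetric]) simp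
    finally show "X = Y" .
  qed
  then show ?thesis unfolding small_universe_def by (blast intro: lepoll_trans)
qed

definition small_MAlg :: "('u set \<Rightarrow> bool) \<Rightarrow> (nat \<Rightarrow> 's set) \<Rightarrow> (('s, 'u) malg, 'u \<Rightarrow> 'u) cat" where
  "small_MAlg small S = full_subcategory (MAlg S) {M. small (mcarr M)}"

definition small_AlgB :: "('u set \<Rightarrow> bool) \<Rightarrow> (nat \<Rightarrow> 's set) \<Rightarrow> (('s, 'u) balg, 'u \<Rightarrow> 'u) cat" where
  "small_AlgB small S = full_subcategory (AlgB S) {B. small (minimals (ord_of B))}"

text \<open>Transport of structure along a map that is injective on the carriers concerned.\<close>

definition relabel_balg :: "('a \<Rightarrow> 'b) \<Rightarrow> (nat \<Rightarrow> 's set) \<Rightarrow> ('s, 'a) balg \<Rightarrow> ('s, 'b) balg" where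
  "relabel_balg c S B = \<lparr>bcarr = c ` bcarr B,
     bop = (\<lambda>(\<sigma>, ys)\<in>op_dom S (c ` bcarr B). c (bop B (\<sigma>, map (inv_into (bcarr B) c) ys))),
     ble = map_prod c c ` ble B\<rparr>"

definition relabel_ftor ::
  "('a \<Rightarrow> 'b) \<Rightarrow> (nat \<Rightarrow> 's set) \<Rightarrow> (('s, 'a) balg, 'a \<Rightarrow> 'a, ('s, 'b) balg, 'b \<Rightarrow> 'b) ftor" where
  "relabel_ftor c S = \<lparr>fobj = relabel_balg c S,
     farr = (\<lambda>A _ h. \<lambda>y\<in>c ` bcarr A. c (h (inv_into (bcarr A) c y)))\<rparr>"

definition coded_P_ftor ::
  "('u set \<Rightarrow> 'u) \<Rightarrow> (nat \<Rightarrow> 's set) \<Rightarrow> (('s, 'u) malg, 'u \<Rightarrow> 'u, ('s, 'u) balg, 'u \<Rightarrow> 'u) ftor" where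
  "coded_P_ftor code S = relabel_ftor code S \<circ>\<^sub>F P_ftor S"

end

theory Submission
  imports Defs
begin

text \<open>
  In a complete atomic Boolean algebra without its bottom, sending an element to the set of atoms
  below it is an order isomorphism onto the non-empty sets of atoms; distributivity with complements
  shows that the supremum of a set of atoms has no further atoms below it. Under this isomorphism
  suprema become unions, the compatibility of the operations with suprema says that they are
  computed from their values on atoms, and a homomorphism is a map whose effect on an element is
  the image of its set of atoms. Hence an ordered algebra is recovered from the
  multialgebra of its atoms, and a multialgebra \<open>M\<close> from the singletons, which are the atoms of
  the non-empty subsets of \<open>M\<close>. In a universe, the coded powerset is an isomorphic relabelling of
  this, so the natural isomorphisms are obtained by composing with the relabelling.
\<close>

section \<open>Bottomless Boolean algebras as powersets of their atoms\<close>

text \<open>The axioms speak of an option type, of bounds and of complements. The locale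
  \<open>powerset_order\<close> replaces them, and both directions of that replacement are needed:
  one exploits the axioms of a given algebra, the other verifies them for powersets and relabelled
  algebras. From \<open>ordered_algebra_iff\<close> and \<open>balg_hom_iff\<close> on, conditions
  are equations or inclusions between sets of atoms, and functor laws and naturality squares are
  computations with images and unions.

  Two obstacles shape the rest. Homomorphisms respect operations only up to inclusion, so a
  bijective homomorphism need not be invertible; isomorphisms are therefore obtained from bijections
  that satisfy an equation for the operations. And taking subsets changes the element type, so
  isomorphisms are built between algebras over different types; they become arrows of one category
  only when \<open>code\<close> leads back to the original type.\<close>

lemma (in partial_order) sup_eqI:
  assumes "least L s (Upper L A)"
  shows "\<Squnion>A = s"
  unfolding sup_def using assms least_unique by (intro some_equality) auto

lemma (in partial_order) inf_eqI:
  assumes "greatest L s (Lower L A)"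
  shows "\<Sqinter>A = s"
  unfolding inf_def using assms greatest_unique by (intro some_equality) auto

text \<open>The laws are verified on sets: \<open>g\<close> turns joins into unions and meets into
  intersections, and equal images force equal elements. It will be applied to the order with
  adjoined bottom, with \<open>X\<close> the set of atoms.\<close>

lemma complete_atomic_boolean_algebra_if_iso_Pow:
  fixes L (structure)
  assumes "partial_order L" and ne: "X \<noteq> {}" and img: "g ` carrier L = Pow X"
    and le: "\<And>x y. x \<in> carrier L \<Longrightarrow> y \<in> carrier L \<Longrightarrow> x \<sqsubseteq> y \<longleftrightarrow> g x \<subseteq> g y"
  shows "complete_atomic_boolean_algebra L"
proof -
  interpret partial_order L by fact
  have inj: "x = y" if "x \<in> carrier L" "y \<in> carrier L" "g x = g y" for x y
    using that le by (intro le_antisym) auto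
  have gX: "g x \<subseteq> X" if "x \<in> carrier L" for x
    using img that by auto
  define f where "f Y = (SOME x. x \<in> carrier L \<and> g x = Y)" for Y
  have f: "f Y \<in> carrier L" "g (f Y) = Y" if "Y \<subseteq> X" for Y
  proof -
    have "\<exists>x. x \<in> carrier L \<and> g x = Y" using that img by (metis PowI imageE)
    from someI_ex[OF this] show "f Y \<in> carrier L" "g (f Y) = Y" by (auto simp: f_def)
  qed
  have lub: "least L (f (\<Union>(g ` A))) (Upper L A)" if A: "A \<subseteq> carrier L" for A
  proof -
    have U: "\<Union>(g ` A) \<subseteq> X" using A gX by blast
    show ?thesis
      by (rule least_UpperI) (use A f[OF U] le in \<open>auto simp: Upper_def subset_iff\<close>)
  qed
  \<comment> \<open>The factor \<open>X\<close> matters for the empty family: its intersection is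
    the whole type, but its infimum must be the top element.\<close>
  have glb: "greatest L (f (X \<inter> \<Inter>(g ` A))) (Lower L A)" if A: "A \<subseteq> carrier L" for A
  proof -
    have U: "X \<inter> \<Inter>(g ` A) \<subseteq> X" by blast
    show ?thesis
      by (rule greatest_LowerI) (use A f[OF U] le gX in \<open>auto simp: Lower_def subset_iff\<close>)
  qed
  have cl: "complete_lattice L"
    by unfold_locales (use lub glb in auto)
  interpret complete_lattice L by (rule cl)
  have g_sup: "g (\<Squnion>A) = \<Union>(g ` A)" if "A \<subseteq> carrier L" for A
    unfolding sup_eqI[OF lub[OF that]] using gX that by (intro f) blast
  have g_inf: "g (\<Sqinter>A) = X \<inter> \<Inter>(g ` A)" if "A \<subseteq> carrier L" for A
    unfolding inf_eqI[OF glb[OF that]] by (intro f) blast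
  have g_join: "g (x \<squnion> y) = g x \<union> g y" if "x \<in> carrier L" "y \<in> carrier L" for x y
    using that g_sup[of "{x, y}"] by (simp add: join_def)
  have g_meet: "g (x \<sqinter> y) = g x \<inter> g y" if "x \<in> carrier L" "y \<in> carrier L" for x y
    using that g_inf[of "{x, y}"] gX by (auto simp add: meet_def)
  have g_bot: "g \<bottom> = {}"
    using le[of \<bottom> "f {}"] f[of "{}"] bottom_lower bottom_closed by auto
  have g_top: "g \<top> = X"
    using le[of "f X" \<top>] f[of X] top_higher top_closed gX by auto
  \<comment> \<open>Singletons are the minimal non-empty sets, so their preimages are atoms.\<close>
  have atom: "f {a} \<in> lattice_atoms L" "g (f {a}) = {a}" if "a \<in> X" for a
  proof -
    show g: "g (f {a}) = {a}" using that f by auto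
    have "x = \<bottom> \<or> x = f {a}" if x: "x \<in> carrier L" "x \<sqsubseteq> f {a}" for x
    proof -
      have "g x = {} \<or> g x = {a}" using le[of x "f {a}"] x f[of "{a}"] \<open>a \<in> X\<close> by auto
      then show ?thesis using inj[of x \<bottom>] inj[of x "f {a}"] g g_bot f[of "{a}"] \<open>a \<in> X\<close> x by auto
    qed
    then show "f {a} \<in> lattice_atoms L"
      using g g_bot f[of "{a}"] that by (auto simp: lattice_atoms_def)
  qed
  have compl: "\<exists>y\<in>carrier L. x \<sqinter> y = \<bottom> \<and> x \<squnion> y = \<top>" if x: "x \<in> carrier L" for x
  proof
    show c: "f (X - g x) \<in> carrier L" using f by auto
    have "g (f (X - g x)) = X - g x" using f by auto
    then show "x \<sqinter> f (X - g x) = \<bottom> \<and> x \<squnion> f (X - g x) = \<top>"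
      using x c gX[OF x] by (auto intro!: inj simp: g_join g_meet g_bot g_top)
  qed
  have at: "x = \<Squnion>{a \<in> lattice_atoms L. a \<sqsubseteq> x}" if x: "x \<in> carrier L" for x
  proof -
    have sub: "{a \<in> lattice_atoms L. a \<sqsubseteq> x} \<subseteq> carrier L" by (auto simp: lattice_atoms_def)
    have "g x = \<Union>(g ` {a \<in> lattice_atoms L. a \<sqsubseteq> x})"
    proof
      \<comment> \<open>Each point \<open>a\<close> of \<open>g x\<close> is contributed by the atom
        \<open>f {a}\<close>.\<close>
      show "g x \<subseteq> \<Union>(g ` {a \<in> lattice_atoms L. a \<sqsubseteq> x})"
      proof
        fix a assume a: "a \<in> g x"
        then have "a \<in> X" using gX x by auto
        with a show "a \<in> \<Union>(g ` {a \<in> lattice_atoms L. a \<sqsubseteq> x})"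
          using atom[of a] f[of "{a}"] le[of "f {a}" x] x by auto
      qed
    qed (use sub le x in blast)
    then show ?thesis using x sub g_sup[OF sub] by (intro inj) auto
  qed
  show ?thesis
    unfolding complete_atomic_boolean_algebra_def
    using cl compl at g_bot g_top ne
    by (auto intro!: inj simp: g_join g_meet)
qed

section \<open>The adjoined bottom and the powerset form of the order axioms\<close>

lemma adjoin_bottom_simps [simp]:
  "carrier (adjoin_bottom L) = insert None (Some ` carrier L)"
  "eq (adjoin_bottom L) = (=)"
  "None \<sqsubseteq>\<^bsub>adjoin_bottom L\<^esub> y"
  "Some a \<sqsubseteq>\<^bsub>adjoin_bottom L\<^esub> Some b \<longleftrightarrow> a \<sqsubseteq>\<^bsub>L\<^esub> b"
  "\<not> Some a \<sqsubseteq>\<^bsub>adjoin_bottom L\<^esub> None"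
  by (auto simp: adjoin_bottom_def)

lemma partial_order_adjoin_bottom:
  assumes "partial_order L"
  shows "partial_order (adjoin_bottom L)"
proof -
  interpret partial_order L by fact
  show ?thesis
    by unfold_locales (auto intro: le_trans)
qed

lemma atoms_below_subset: "atoms_below L x \<subseteq> minimals L"
  by (auto simp: atoms_below_def)

lemma minimals_subset: "minimals L \<subseteq> carrier L"
  by (auto simp: minimals_def)

text \<open>This form mentions neither the adjoined bottom nor suprema. The condition
  \<open>minimals_nonempty\<close> excludes exactly the empty order, for which both sides of
  \<open>atoms_below_image\<close> are empty.\<close>

locale powerset_order = partial_order L for L (structure) +
  assumes minimals_nonempty: "minimals L \<noteq> {}"
    and atoms_below_image: "atoms_below L ` carrier L = Pow_ne (minimals L)"
    and le_iff: "x \<in> carrier L \<Longrightarrow> y \<in> carrier L \<Longrightarrow> x \<sqsubseteq> y \<longleftrightarrow> atoms_below L x \<subseteq> atoms_below L y"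

lemma (in powerset_order) atoms_below_nonempty: "x \<in> carrier L \<Longrightarrow> atoms_below L x \<noteq> {}"
  using atoms_below_image by (auto simp: Pow_ne_def)

lemma powerset_order_imp_bottomless:
  assumes "powerset_order L"
  shows "bottomless_boolean_algebra L"
proof -
  interpret powerset_order L by fact
  \<comment> \<open>The adjoined bottom \<open>None\<close> corresponds to the empty set of atoms,
    which completes \<open>Pow_ne\<close> to \<open>Pow\<close>.\<close>
  define g where "g = case_option {} (atoms_below L)"
  have "g ` carrier (adjoin_bottom L) = Pow (minimals L)"
    using atoms_below_image by (auto simp: g_def image_image Pow_ne_def)
  moreover have "x \<sqsubseteq>\<^bsub>adjoin_bottom L\<^esub> y \<longleftrightarrow> g x \<subseteq> g y"
    if "x \<in> carrier (adjoin_bottom L)" "y \<in> carrier (adjoin_bottom L)" for x y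
    using that le_iff atoms_below_nonempty by (cases x; cases y) (auto simp: g_def)
  ultimately have "complete_atomic_boolean_algebra (adjoin_bottom L)"
    by (intro complete_atomic_boolean_algebra_if_iso_Pow[where g = g and X = "minimals L"]
        partial_order_adjoin_bottom partial_order_axioms minimals_nonempty)
  then show ?thesis
    using minimals_nonempty partial_order_axioms minimals_subset[of L]
    by (auto simp: bottomless_boolean_algebra_def)
qed

text \<open>Atomicity gives the comparison of atom sets. Surjectivity is harder because only binary
  distributivity is assumed: an atom \<open>a\<close> below the supremum of \<open>T\<close> but
  outside \<open>T\<close> is excluded by its complement \<open>b\<close>, which bounds all of
  \<open>T\<close> and hence \<open>a\<close> itself.\<close>

lemma bottomless_imp_powerset_order:
  fixes L (structure)
  assumes "bottomless_boolean_algebra L"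
  shows "powerset_order L"
proof -
  let ?K = "adjoin_bottom L"
  interpret partial_order L using assms by (simp add: bottomless_boolean_algebra_def)
  have K: "complete_atomic_boolean_algebra ?K" and ne: "carrier L \<noteq> {}"
    using assms by (auto simp: bottomless_boolean_algebra_def)
  interpret K: complete_lattice ?K
    using K by (simp add: complete_atomic_boolean_algebra_def)
  have bot: "\<bottom>\<^bsub>?K\<^esub> = None"
    using K.bottom_lower[of None] K.bottom_closed by (cases "\<bottom>\<^bsub>?K\<^esub>") auto
  have atoms: "lattice_atoms ?K = Some ` minimals L"
    by (auto simp: lattice_atoms_def minimals_def bot)
  have sup_atoms: "Some x = \<Squnion>\<^bsub>?K\<^esub>(Some ` atoms_below L x)" if "x \<in> carrier L" for x
  proof -
    have "{a \<in> lattice_atoms ?K. a \<sqsubseteq>\<^bsub>?K\<^esub> Some x} = Some ` atoms_below L x"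
      by (auto simp: atoms atoms_below_def)
    then show ?thesis using K that by (auto simp: complete_atomic_boolean_algebra_def)
  qed
  have sub: "Some ` T \<subseteq> carrier ?K" if "T \<subseteq> minimals L" for T
    using that minimals_subset[of L] by auto
  have ab_ne: "atoms_below L x \<noteq> {}" if "x \<in> carrier L" for x
  proof
    \<comment> \<open>The empty supremum is the adjoined bottom, which is not of the form
      \<open>Some x\<close>.\<close>
    assume "atoms_below L x = {}"
    then have "Some x = \<Squnion>\<^bsub>?K\<^esub>{}" using sup_atoms[OF that] by simp
    then show False using K.weak_sup_empty bot by simp
  qed
  have le: "x \<sqsubseteq> y \<longleftrightarrow> atoms_below L x \<subseteq> atoms_below L y"
    if x: "x \<in> carrier L" and y: "y \<in> carrier L" for x y
  proof
    assume "x \<sqsubseteq> y"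
    then show "atoms_below L x \<subseteq> atoms_below L y"
      using x y minimals_subset[of L] by (auto simp: atoms_below_def intro: le_trans)
  next
    assume s: "atoms_below L x \<subseteq> atoms_below L y"
    have "\<Squnion>\<^bsub>?K\<^esub>(Some ` atoms_below L x) \<sqsubseteq>\<^bsub>?K\<^esub> Some y"
      using s y sub[OF atoms_below_subset[of L x]] by (intro K.sup_least) (auto simp: atoms_below_def)
    then show "x \<sqsubseteq> y" unfolding sup_atoms[OF x, symmetric] by simp
  qed
  have ex: "\<exists>s\<in>carrier L. atoms_below L s = T" if T: "T \<subseteq> minimals L" "T \<noteq> {}" for T
  proof -
    note subT = sub[OF T(1)]
    have up: "Some t \<sqsubseteq>\<^bsub>?K\<^esub> \<Squnion>\<^bsub>?K\<^esub>(Some ` T)" if "t \<in> T" for t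
      using K.sup_upper[OF subT] that by auto
    \<comment> \<open>Non-emptiness of \<open>T\<close> keeps the supremum away from the adjoined
      bottom.\<close>
    obtain s where s: "\<Squnion>\<^bsub>?K\<^esub>(Some ` T) = Some s" "s \<in> carrier L"
      using K.sup_closed[OF subT] up T(2) by fastforce
    have "a \<in> T" if a: "a \<in> minimals L" "a \<sqsubseteq> s" for a
    proof (rule ccontr)
      assume "a \<notin> T"
      have ac: "Some a \<in> carrier ?K" using a minimals_subset[of L] by auto
      obtain b where b: "b \<in> carrier ?K" "Some a \<sqinter>\<^bsub>?K\<^esub> b = \<bottom>\<^bsub>?K\<^esub>" "Some a \<squnion>\<^bsub>?K\<^esub> b = \<top>\<^bsub>?K\<^esub>"
        using K ac unfolding complete_atomic_boolean_algebra_def by blast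
      \<comment> \<open>An atom different from \<open>a\<close> lies below the complement \<open>b\<close> of \<open>a\<close>, by distributivity.\<close>
      have "Some t \<sqsubseteq>\<^bsub>?K\<^esub> b" if "t \<in> T" for t
      proof -
        have t: "t \<in> minimals L" and tc: "Some t \<in> carrier ?K" using that T subT by auto
        \<comment> \<open>A non-bottom meet would lie below both atoms and so equal both, although
          \<open>t\<close> is in \<open>T\<close> and \<open>a\<close> is not.\<close>
        have "Some t \<sqinter>\<^bsub>?K\<^esub> Some a = None"
        proof (rule ccontr)
          assume "\<not> ?thesis"
          then obtain m where m: "Some t \<sqinter>\<^bsub>?K\<^esub> Some a = Some m" "m \<in> carrier L"
            using K.meet_closed[OF tc ac] by auto
          then have "m \<sqsubseteq> t" "m \<sqsubseteq> a"
            using K.meet_left[OF tc ac] K.meet_right[OF tc ac] by auto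
          then show False using m t a \<open>a \<notin> T\<close> that by (auto simp: minimals_def)
        qed
        moreover have "Some t = Some t \<sqinter>\<^bsub>?K\<^esub> (Some a \<squnion>\<^bsub>?K\<^esub> b)"
          unfolding b(3) using K.top_meet[OF tc] tc meet_comm K.eq_is_equal by metis
        moreover have "Some t \<sqinter>\<^bsub>?K\<^esub> (Some a \<squnion>\<^bsub>?K\<^esub> b) =
            (Some t \<sqinter>\<^bsub>?K\<^esub> Some a) \<squnion>\<^bsub>?K\<^esub> (Some t \<sqinter>\<^bsub>?K\<^esub> b)"
          using K tc ac b unfolding complete_atomic_boolean_algebra_def by blast
        moreover have "\<bottom>\<^bsub>?K\<^esub> \<squnion>\<^bsub>?K\<^esub> (Some t \<sqinter>\<^bsub>?K\<^esub> b) = Some t \<sqinter>\<^bsub>?K\<^esub> b"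
          using K.bottom_join[OF K.meet_closed[OF tc b(1)]] K.eq_is_equal by metis
        ultimately have "Some t = Some t \<sqinter>\<^bsub>?K\<^esub> b" using bot by simp
        then show ?thesis using K.meet_right[OF tc b(1)] by simp
      qed
      then have sb: "Some s \<sqsubseteq>\<^bsub>?K\<^esub> b"
        unfolding s(1)[symmetric] using subT b by (intro K.sup_least) auto
      have "Some a \<sqsubseteq>\<^bsub>?K\<^esub> b"
        by (rule K.le_trans[OF _ sb]) (use ac s b a in auto)
      \<comment> \<open>Being below both \<open>a\<close> and its complement, \<open>a\<close> would
        lie below the bottom.\<close>
      then have "Some a \<sqsubseteq>\<^bsub>?K\<^esub> Some a \<sqinter>\<^bsub>?K\<^esub> b"
        using ac b(1) by (intro K.meet_le) auto
      then show False using b bot by simp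
    qed
    then have "atoms_below L s = T"
      using T up s by (auto simp: atoms_below_def)
    then show ?thesis using s by auto
  qed
  show ?thesis
  proof unfold_locales
    show "minimals L \<noteq> {}" using ne ab_ne atoms_below_subset[of L] by auto
    show "atoms_below L ` carrier L = Pow_ne (minimals L)"
    proof
      show "atoms_below L ` carrier L \<subseteq> Pow_ne (minimals L)"
        using ab_ne atoms_below_subset[of L] by (auto simp: Pow_ne_def)
      show "Pow_ne (minimals L) \<subseteq> atoms_below L ` carrier L"
      proof
        fix T assume "T \<in> Pow_ne (minimals L)"
        then obtain s where "s \<in> carrier L" "atoms_below L s = T"
          using ex[of T] by (auto simp: Pow_ne_def)
        then show "T \<in> atoms_below L ` carrier L" by auto
      qed
    qed
  qed (fact le)
qed

lemma bottomless_iff_powerset_order: "bottomless_boolean_algebra L \<longleftrightarrow> powerset_order L"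
  using bottomless_imp_powerset_order powerset_order_imp_bottomless by blast

section \<open>Suprema as unions of atom sets, and order isomorphisms\<close>

context powerset_order
begin

lemma atoms_below_inj:
  "x \<in> carrier L \<Longrightarrow> y \<in> carrier L \<Longrightarrow> atoms_below L x = atoms_below L y \<Longrightarrow> x = y"
  using le_iff by (intro le_antisym) auto

lemma atoms_below_bij: "bij_betw (atoms_below L) (carrier L) (Pow_ne (minimals L))"
  unfolding bij_betw_def using atoms_below_image atoms_below_inj by (auto intro: inj_onI)

lemma atoms_below_minimal: "x \<in> minimals L \<Longrightarrow> atoms_below L x = {x}"
  using minimals_subset[of L] by (auto simp: atoms_below_def minimals_def)

text \<open>A non-empty union of atom sets is again a non-empty set of atoms, so it belongs to some
  \<open>s\<close> of the carrier; comparing atom sets shows that \<open>s\<close> is the least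
  upper bound. Non-emptiness of \<open>A\<close> is essential, since there is no bottom to serve as
  the empty supremum.\<close>

lemma
  assumes A: "A \<subseteq> carrier L" "A \<noteq> {}"
  shows sup_in_carrier: "\<Squnion>A \<in> carrier L"
    and atoms_below_sup: "atoms_below L (\<Squnion>A) = \<Union>(atoms_below L ` A)"
proof -
  have "\<Union>(atoms_below L ` A) \<in> Pow_ne (minimals L)"
    using A atoms_below_nonempty atoms_below_subset[of L] by (auto simp: Pow_ne_def) blast
  then obtain s where s: "s \<in> carrier L" "atoms_below L s = \<Union>(atoms_below L ` A)"
    using atoms_below_image by (metis imageE)
  have "least L s (Upper L A)"
    by (rule least_UpperI) (use A s le_iff in \<open>auto simp: Upper_def subset_iff\<close>)
  then have "\<Squnion>A = s" by (rule sup_eqI)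
  then show "\<Squnion>A \<in> carrier L" "atoms_below L (\<Squnion>A) = \<Union>(atoms_below L ` A)" using s by auto
qed

lemma sup_atoms_below: "x \<in> carrier L \<Longrightarrow> \<Squnion>(atoms_below L x) = x"
  using atoms_below_nonempty[of x] atoms_below_subset[of L x] minimals_subset[of L] atoms_below_minimal
  by (intro atoms_below_inj) (auto simp: atoms_below_sup sup_in_carrier subset_iff)

end

lemma
  fixes f :: "'a \<Rightarrow> 'b" and L :: "'a gorder" and K :: "'b gorder"
  assumes bij: "bij_betw f (carrier L) (carrier K)"
    and le: "\<And>x y. x \<in> carrier L \<Longrightarrow> y \<in> carrier L \<Longrightarrow> f x \<sqsubseteq>\<^bsub>K\<^esub> f y \<longleftrightarrow> x \<sqsubseteq>\<^bsub>L\<^esub> y"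
  shows order_iso_minimals: "minimals K = f ` minimals L"
    and order_iso_atoms_below: "x \<in> carrier L \<Longrightarrow> atoms_below K (f x) = f ` atoms_below L x"
proof -
  have K: "carrier K = f ` carrier L" and inj: "inj_on f (carrier L)"
    using bij by (auto simp: bij_betw_def)
  show m: "minimals K = f ` minimals L"
    unfolding minimals_def K using inj le by (auto simp: inj_on_eq_iff)
  show "atoms_below K (f x) = f ` atoms_below L x" if "x \<in> carrier L"
    unfolding atoms_below_def m using le that minimals_subset[of L] by auto
qed

section \<open>Ordered algebras in terms of atoms\<close>

lemma in_listset_iff: "ys \<in> listset Xs \<longleftrightarrow> list_all2 (\<in>) ys Xs"
  by (induction Xs arbitrary: ys) (auto simp: set_Cons_def list_all2_Cons2)

lemma listset_map_image: "listset (map ((`) f) Xs) = map f ` listset Xs"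
proof (induction Xs)
  case (Cons X Xs)
  then show ?case by (force simp: set_Cons_def image_iff)
qed simp

lemma listset_map_singleton: "listset (map (\<lambda>x. {x}) xs) = {xs}"
  by (induction xs) (auto simp: set_Cons_def)

lemma length_listset: "ys \<in> listset Xs \<Longrightarrow> length ys = length Xs"
  by (auto simp: in_listset_iff list_all2_lengthD)

lemma set_listset: "ys \<in> listset Xs \<Longrightarrow> set ys \<subseteq> \<Union>(set Xs)"
  by (fastforce simp: in_listset_iff list_all2_conv_all_nth in_set_conv_nth)

lemma listset_nonempty: "{} \<notin> set Xs \<Longrightarrow> listset Xs \<noteq> {}"
  by (induction Xs) (auto simp: set_Cons_def)

lemma op_domD: "(\<sigma>, xs) \<in> op_dom S A \<Longrightarrow> \<sigma> \<in> S (length xs) \<and> set xs \<subseteq> A"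
  by (simp add: op_dom_def)

lemma op_dom_map: "(\<sigma>, xs) \<in> op_dom S A \<Longrightarrow> h ` A \<subseteq> B \<Longrightarrow> (\<sigma>, map h xs) \<in> op_dom S B"
  by (auto simp: op_dom_def)

text \<open>Membership in a product fixes the length, so the arity condition carries over from
  \<open>xs\<close> to \<open>ys\<close>.\<close>

lemma op_dom_listset:
  assumes "(\<sigma>, xs) \<in> op_dom S A" "ys \<in> listset (map F xs)" "\<And>x. x \<in> A \<Longrightarrow> F x \<subseteq> B"
  shows "(\<sigma>, ys) \<in> op_dom S B"
  using assms length_listset[OF assms(2)] set_listset[OF assms(2)] by (fastforce simp: op_dom_def)

lemma map_restrict: "set xs \<subseteq> A \<Longrightarrow> map (restrict f A) xs = map f xs"
  by (auto simp: subset_iff)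

lemma compose_in_PiE:
  "f \<in> A \<rightarrow>\<^sub>E B \<Longrightarrow> g \<in> B \<rightarrow>\<^sub>E C \<Longrightarrow> compose A g f \<in> A \<rightarrow>\<^sub>E C"
  by (auto simp: compose_def)

lemma map_compose: "set xs \<subseteq> A \<Longrightarrow> map (compose A g f) xs = map g (map f xs)"
  by (auto simp: compose_def subset_iff)

section \<open>Algebras and homomorphisms described by sets of atoms\<close>

lemma ord_of_simps [simp]:
  "carrier (ord_of B) = bcarr B"
  "x \<sqsubseteq>\<^bsub>ord_of B\<^esub> y \<longleftrightarrow> (x, y) \<in> ble B"
  "eq (ord_of B) = (=)"
  by (simp_all add: ord_of_def)

abbreviation atoms :: "('s, 'a) balg \<Rightarrow> 'a set" where
  "atoms B \<equiv> minimals (ord_of B)"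

abbreviation at_below :: "('s, 'a) balg \<Rightarrow> 'a \<Rightarrow> 'a set" where
  "at_below B \<equiv> atoms_below (ord_of B)"

lemma atoms_subset_bcarr: "atoms B \<subseteq> bcarr B"
  using minimals_subset[of "ord_of B"] by simp

lemma at_below_subset_bcarr: "at_below B x \<subseteq> bcarr B"
  using atoms_below_subset[of "ord_of B" x] atoms_subset_bcarr[of B] by blast

text \<open>Elements are determined by their atoms, and the atoms below a supremum form the union of
  the atom sets; applying \<open>at_below\<close> to both sides of the supremum law therefore loses
  nothing.\<close>

lemma ordered_algebra_iff:
  "ordered_algebra S B \<longleftrightarrow>
     bop B \<in> op_dom S (bcarr B) \<rightarrow>\<^sub>E bcarr B \<and> ble B \<subseteq> bcarr B \<times> bcarr B \<and> powerset_order (ord_of B) \<and>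
     (\<forall>\<sigma> xs. (\<sigma>, xs) \<in> op_dom S (bcarr B) \<longrightarrow>
        at_below B (bop B (\<sigma>, xs)) = (\<Union>ys\<in>listset (map (at_below B) xs). at_below B (bop B (\<sigma>, ys))))"
proof -
  have key: "bop B (\<sigma>, xs) = \<Squnion>\<^bsub>ord_of B\<^esub>{bop B (\<sigma>, ys) | ys. ys \<in> listset (map (at_below B) xs)} \<longleftrightarrow>
      at_below B (bop B (\<sigma>, xs)) = (\<Union>ys\<in>listset (map (at_below B) xs). at_below B (bop B (\<sigma>, ys)))"
    if op: "bop B \<in> op_dom S (bcarr B) \<rightarrow>\<^sub>E bcarr B" and "powerset_order (ord_of B)"
      and xs: "(\<sigma>, xs) \<in> op_dom S (bcarr B)" for \<sigma> xs
  proof -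
    let ?X = "{bop B (\<sigma>, ys) | ys. ys \<in> listset (map (at_below B) xs)}"
    interpret powerset_order "ord_of B" by fact
    have "(\<sigma>, ys) \<in> op_dom S (bcarr B)" if "ys \<in> listset (map (at_below B) xs)" for ys
      by (rule op_dom_listset[OF xs that]) (rule at_below_subset_bcarr)
    then have X: "?X \<subseteq> carrier (ord_of B)" using op by auto
    \<comment> \<open>Every entry has an atom below it, so the product of the atom sets is non-empty
      and \<open>atoms_below_sup\<close> applies.\<close>
    have "listset (map (at_below B) xs) \<noteq> {}"
      using op_domD[OF xs] atoms_below_nonempty by (intro listset_nonempty) auto
    then have ne: "?X \<noteq> {}" by auto
    have "bop B (\<sigma>, xs) \<in> carrier (ord_of B)" using op xs by auto
    note inj = atoms_below_inj[OF this sup_in_carrier[OF X ne]]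
    have "bop B (\<sigma>, xs) = \<Squnion>\<^bsub>ord_of B\<^esub>?X \<longleftrightarrow> at_below B (bop B (\<sigma>, xs)) = at_below B (\<Squnion>\<^bsub>ord_of B\<^esub>?X)"
      by (rule iffI[OF arg_cong inj])
    also have "at_below B (\<Squnion>\<^bsub>ord_of B\<^esub>?X) =
        (\<Union>ys\<in>listset (map (at_below B) xs). at_below B (bop B (\<sigma>, ys)))"
      unfolding atoms_below_sup[OF X ne] by auto
    finally show ?thesis .
  qed
  show ?thesis
    unfolding ordered_algebra_def bottomless_iff_powerset_order Ball_def split_paired_All prod.case
    by (intro conj_cong refl all_cong1 imp_cong) (rule key; assumption)
qed

text \<open>The single equation on atom sets combines preservation of suprema with preservation of
  minimal elements. One direction evaluates \<open>h\<close> on an element written as the supremum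
  of its atoms; the other compares atom sets, and on an atom reads the equation as one between
  singletons.\<close>

lemma balg_hom_iff:
  assumes "powerset_order (ord_of A)" "powerset_order (ord_of B)"
    and opA: "bop A \<in> op_dom S (bcarr A) \<rightarrow>\<^sub>E bcarr A" and opB: "bop B \<in> op_dom S (bcarr B) \<rightarrow>\<^sub>E bcarr B"
  shows "h \<in> balg_hom S A B \<longleftrightarrow>
     h \<in> bcarr A \<rightarrow>\<^sub>E bcarr B \<and>
     (\<forall>x\<in>bcarr A. at_below B (h x) = h ` at_below A x) \<and>
     (\<forall>\<sigma> xs. (\<sigma>, xs) \<in> op_dom S (bcarr A) \<longrightarrow>
        h ` at_below A (bop A (\<sigma>, xs)) \<subseteq> at_below B (bop B (\<sigma>, map h xs)))"
    (is "_ \<longleftrightarrow> ?h \<and> ?at \<and> ?op")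
proof -
  interpret A: powerset_order "ord_of A" by fact
  interpret B: powerset_order "ord_of B" by fact
  have sup_iff: "(\<forall>X. X \<subseteq> bcarr A \<and> X \<noteq> {} \<longrightarrow> h (\<Squnion>\<^bsub>ord_of A\<^esub>X) = \<Squnion>\<^bsub>ord_of B\<^esub>(h ` X)) \<and>
      h ` atoms A \<subseteq> atoms B \<longleftrightarrow> ?at" if h: ?h
  proof (intro iffI ballI conjI allI impI; (elim conjE)?)
    fix x
    assume s: "\<forall>X. X \<subseteq> bcarr A \<and> X \<noteq> {} \<longrightarrow> h (\<Squnion>\<^bsub>ord_of A\<^esub>X) = \<Squnion>\<^bsub>ord_of B\<^esub>(h ` X)"
      and m: "h ` atoms A \<subseteq> atoms B" and x: "x \<in> bcarr A"
    have ne: "at_below A x \<noteq> {}" using x A.atoms_below_nonempty by simp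
    have sub: "h ` at_below A x \<subseteq> atoms B" using m atoms_below_subset[of "ord_of A" x] by blast
    \<comment> \<open>Since \<open>x\<close> is the supremum of its atoms, \<open>h x\<close> is a
      supremum of atoms of \<open>B\<close>, and no further atoms lie below it.\<close>
    have "h x = \<Squnion>\<^bsub>ord_of B\<^esub>(h ` at_below A x)"
      using s ne at_below_subset_bcarr[of A x] A.sup_atoms_below[of x] x by auto
    also have "at_below B \<dots> = \<Union>(at_below B ` h ` at_below A x)"
      using ne sub atoms_subset_bcarr[of B] by (intro B.atoms_below_sup) auto
    also have "\<dots> = h ` at_below A x"
      using sub B.atoms_below_minimal by auto
    finally show "at_below B (h x) = h ` at_below A x" .
  next
    fix X assume a: ?at and X: "X \<subseteq> bcarr A" "X \<noteq> {}"
    have hX: "h ` X \<subseteq> carrier (ord_of B)" "h ` X \<noteq> {}" using h X by auto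
    have sX: "\<Squnion>\<^bsub>ord_of A\<^esub>X \<in> bcarr A" using A.sup_in_carrier[of X] X by simp
    have "at_below B (h (\<Squnion>\<^bsub>ord_of A\<^esub>X)) = h ` at_below A (\<Squnion>\<^bsub>ord_of A\<^esub>X)"
      using a sX by blast
    also have "\<dots> = (\<Union>x\<in>X. h ` at_below A x)"
      using A.atoms_below_sup[of X] X by (simp add: image_UN)
    also have "\<dots> = (\<Union>x\<in>X. at_below B (h x))"
      using a X by (intro SUP_cong refl) auto
    also have "\<dots> = at_below B (\<Squnion>\<^bsub>ord_of B\<^esub>(h ` X))"
      unfolding B.atoms_below_sup[OF hX] by simp
    finally show "h (\<Squnion>\<^bsub>ord_of A\<^esub>X) = \<Squnion>\<^bsub>ord_of B\<^esub>(h ` X)"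
      using h sX B.sup_in_carrier[OF hX] by (intro B.atoms_below_inj) auto
  next
    assume a: ?at
    show "h ` atoms A \<subseteq> atoms B"
    proof (rule image_subsetI)
      fix x assume x: "x \<in> atoms A"
      \<comment> \<open>The set of atoms below \<open>h x\<close> consists of \<open>h x\<close>
        alone, so \<open>h x\<close> is itself an atom.\<close>
      then have "at_below B (h x) = {h x}"
        using a A.atoms_below_minimal atoms_subset_bcarr[of A] by auto
      then show "h x \<in> atoms B" using atoms_below_subset[of "ord_of B" "h x"] by auto
    qed
  qed
  have op_iff: "h (bop A (\<sigma>, xs)) \<sqsubseteq>\<^bsub>ord_of B\<^esub> bop B (\<sigma>, map h xs) \<longleftrightarrow>
      h ` at_below A (bop A (\<sigma>, xs)) \<subseteq> at_below B (bop B (\<sigma>, map h xs))"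
    if h: ?h and a: ?at and xs: "(\<sigma>, xs) \<in> op_dom S (bcarr A)" for \<sigma> xs
  proof -
    have "(\<sigma>, map h xs) \<in> op_dom S (bcarr B)" using h by (intro op_dom_map[OF xs]) auto
    then have 1: "bop B (\<sigma>, map h xs) \<in> carrier (ord_of B)" using opB by auto
    have 2: "bop A (\<sigma>, xs) \<in> bcarr A" using opA xs by auto
    have 3: "h (bop A (\<sigma>, xs)) \<in> carrier (ord_of B)" using h 2 by auto
    show ?thesis using B.le_iff[OF 3 1] a 2 by auto
  qed
  have "h \<in> balg_hom S A B \<longleftrightarrow> ?h \<and>
      ((\<forall>X. X \<subseteq> bcarr A \<and> X \<noteq> {} \<longrightarrow> h (\<Squnion>\<^bsub>ord_of A\<^esub>X) = \<Squnion>\<^bsub>ord_of B\<^esub>(h ` X)) \<and>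
        h ` atoms A \<subseteq> atoms B) \<and>
      (\<forall>\<sigma> xs. (\<sigma>, xs) \<in> op_dom S (bcarr A) \<longrightarrow>
        h (bop A (\<sigma>, xs)) \<sqsubseteq>\<^bsub>ord_of B\<^esub> bop B (\<sigma>, map h xs))"
    unfolding balg_hom_def mem_Collect_eq Ball_def split_paired_All prod.case by argo
  also have "\<dots> \<longleftrightarrow> ?h \<and> ?at \<and> ?op"
    by (intro conj_cong refl all_cong1 imp_cong) (rule sup_iff op_iff; assumption)+
  finally show ?thesis .
qed

section \<open>The categories of multialgebras and of ordered algebras\<close>

lemma category_full_subcategory: "category C \<Longrightarrow> category (full_subcategory C X)"
  by (auto simp: category_def full_subcategory_def)

lemma full_subcategory_simps [simp]:
  "Obj (full_subcategory C X) = Obj C \<inter> X"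
  "Hom (full_subcategory C X) = Hom C"
  "Ident (full_subcategory C X) = Ident C"
  "Comp (full_subcategory C X) = Comp C"
  by (simp_all add: full_subcategory_def)

text \<open>Fullness leaves the arrows and their laws untouched, so only the objects have to be
  checked.\<close>

lemma is_functor_full_subcategory:
  assumes "is_functor C D F" "\<And>X. X \<in> Obj C \<Longrightarrow> X \<in> A \<Longrightarrow> fobj F X \<in> B"
  shows "is_functor (full_subcategory C A) (full_subcategory D B) F"
  using assms category_full_subcategory[of C A] category_full_subcategory[of D B]
  unfolding is_functor_def by auto

lemma is_functor_id: "category C \<Longrightarrow> is_functor C C id_ftor"
  by (simp add: is_functor_def id_ftor_def)

lemma is_functor_comp:
  assumes "is_functor C D F" "is_functor D E G"
  shows "is_functor C E (G \<circ>\<^sub>F F)"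
  using assms unfolding is_functor_def comp_ftor_def by simp

lemma MAlg_simps [simp]:
  "Obj (MAlg S) = {M. multialgebra S M}"
  "Hom (MAlg S) = malg_hom S"
  "Ident (MAlg S) M = (\<lambda>x\<in>mcarr M. x)"
  "Comp (MAlg S) M N P g f = compose (mcarr M) g f"
  by (simp_all add: MAlg_def)

lemma AlgB_simps [simp]:
  "Obj (AlgB S) = {B. ordered_algebra S B}"
  "Hom (AlgB S) = balg_hom S"
  "Ident (AlgB S) B = (\<lambda>x\<in>bcarr B. x)"
  "Comp (AlgB S) A B C g f = compose (bcarr A) g f"
  by (simp_all add: AlgB_def)

section \<open>The category of multialgebras\<close>

lemma malg_hom_iff:
  "h \<in> malg_hom S M N \<longleftrightarrow> h \<in> mcarr M \<rightarrow>\<^sub>E mcarr N \<and>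
     (\<forall>\<sigma> xs. (\<sigma>, xs) \<in> op_dom S (mcarr M) \<longrightarrow> h ` mop M (\<sigma>, xs) \<subseteq> mop N (\<sigma>, map h xs))"
  by (auto simp: malg_hom_def Ball_def)

lemma multialgebra_mop_subset:
  "multialgebra S M \<Longrightarrow> (\<sigma>, xs) \<in> op_dom S (mcarr M) \<Longrightarrow> mop M (\<sigma>, xs) \<subseteq> mcarr M"
  unfolding multialgebra_def Pow_ne_def by fast

lemma multialgebra_mop_nonempty:
  "multialgebra S M \<Longrightarrow> (\<sigma>, xs) \<in> op_dom S (mcarr M) \<Longrightarrow> mop M (\<sigma>, xs) \<noteq> {}"
  unfolding multialgebra_def Pow_ne_def by fast

lemma malg_hom_id: "multialgebra S M \<Longrightarrow> (\<lambda>x\<in>mcarr M. x) \<in> malg_hom S M M"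
  unfolding malg_hom_iff
  using multialgebra_mop_subset[of S M] by (auto simp: map_restrict op_dom_def subset_iff)

lemma malg_hom_compose:
  assumes M: "multialgebra S M" and f: "f \<in> malg_hom S M N" and g: "g \<in> malg_hom S N P"
  shows "compose (mcarr M) g f \<in> malg_hom S M P"
  unfolding malg_hom_iff
proof (intro conjI allI impI)
  have fN: "f \<in> mcarr M \<rightarrow>\<^sub>E mcarr N" and gP: "g \<in> mcarr N \<rightarrow>\<^sub>E mcarr P"
    using f g by (auto simp: malg_hom_iff)
  then show "compose (mcarr M) g f \<in> mcarr M \<rightarrow>\<^sub>E mcarr P" by (rule compose_in_PiE)
  fix \<sigma> xs assume xs: "(\<sigma>, xs) \<in> op_dom S (mcarr M)"
  have "(\<sigma>, map f xs) \<in> op_dom S (mcarr N)" using fN by (intro op_dom_map[OF xs]) auto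
  then have gN: "g ` mop N (\<sigma>, map f xs) \<subseteq> mop P (\<sigma>, map g (map f xs))"
    using g unfolding malg_hom_iff by blast
  have fM: "f ` mop M (\<sigma>, xs) \<subseteq> mop N (\<sigma>, map f xs)" using f xs by (simp add: malg_hom_iff)
  \<comment> \<open>Composition is cut off at the carrier of \<open>M\<close>, so this rewriting
    needs the values of the multioperation to lie in it.\<close>
  have im: "compose (mcarr M) g f ` mop M (\<sigma>, xs) = g ` f ` mop M (\<sigma>, xs)"
    using multialgebra_mop_subset[OF M xs] by (force simp: compose_def image_image)
  have mp: "map (compose (mcarr M) g f) xs = map g (map f xs)"
    using op_domD[OF xs] by (intro map_compose) simp
  show "compose (mcarr M) g f ` mop M (\<sigma>, xs) \<subseteq> mop P (\<sigma>, map (compose (mcarr M) g f) xs)"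
    unfolding im mp by (rule subset_trans[OF image_mono[OF fM] gN])
qed

lemma compose_restrict_id_right: "f \<in> A \<rightarrow>\<^sub>E B \<Longrightarrow> compose A f (\<lambda>x\<in>A. x) = f"
  by (auto simp: compose_def fun_eq_iff PiE_def extensional_def)

lemma compose_restrict_id_left: "f \<in> A \<rightarrow>\<^sub>E B \<Longrightarrow> compose A (\<lambda>x\<in>B. x) f = f"
  by (auto simp: compose_def fun_eq_iff PiE_def extensional_def)

lemma compose_compose:
  "f \<in> A \<rightarrow>\<^sub>E B \<Longrightarrow> compose A (compose B h g) f = compose A h (compose A g f)"
  by (auto simp: compose_def fun_eq_iff PiE_def Pi_def)

lemma malg_hom_PiE: "h \<in> malg_hom S M N \<Longrightarrow> h \<in> mcarr M \<rightarrow>\<^sub>E mcarr N"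
  by (simp add: malg_hom_iff)

lemma balg_hom_PiE: "h \<in> balg_hom S A B \<Longrightarrow> h \<in> bcarr A \<rightarrow>\<^sub>E bcarr B"
  by (simp add: balg_hom_def)

lemma category_MAlg: "category (MAlg S)"
  unfolding category_def MAlg_simps mem_Collect_eq
  by (intro conjI ballI; unfold mem_Collect_eq)
    (rule malg_hom_id malg_hom_compose compose_restrict_id_left[OF malg_hom_PiE]
      compose_restrict_id_right[OF malg_hom_PiE] compose_compose[OF malg_hom_PiE]; assumption)+

section \<open>The category of ordered algebras\<close>

lemma ordered_algebra_op: "ordered_algebra S B \<Longrightarrow> bop B \<in> op_dom S (bcarr B) \<rightarrow>\<^sub>E bcarr B"
  and ordered_algebra_order: "ordered_algebra S B \<Longrightarrow> powerset_order (ord_of B)"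
  and ordered_algebra_atoms: "ordered_algebra S B \<Longrightarrow> (\<sigma>, xs) \<in> op_dom S (bcarr B) \<Longrightarrow>
    at_below B (bop B (\<sigma>, xs)) = (\<Union>ys\<in>listset (map (at_below B) xs). at_below B (bop B (\<sigma>, ys)))"
  by (simp_all add: ordered_algebra_iff)

lemma ordered_algebra_bop: "ordered_algebra S B \<Longrightarrow> (\<sigma>, xs) \<in> op_dom S (bcarr B) \<Longrightarrow> bop B (\<sigma>, xs) \<in> bcarr B"
  using ordered_algebra_op by fast

lemma balg_homI:
  assumes "ordered_algebra S A" "ordered_algebra S B" "h \<in> bcarr A \<rightarrow>\<^sub>E bcarr B"
    and "\<And>x. x \<in> bcarr A \<Longrightarrow> at_below B (h x) = h ` at_below A x"
    and "\<And>\<sigma> xs. (\<sigma>, xs) \<in> op_dom S (bcarr A) \<Longrightarrow>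
        h ` at_below A (bop A (\<sigma>, xs)) \<subseteq> at_below B (bop B (\<sigma>, map h xs))"
  shows "h \<in> balg_hom S A B"
  using assms by (simp add: balg_hom_iff ordered_algebra_op ordered_algebra_order)

lemma
  assumes "ordered_algebra S A" "ordered_algebra S B" "h \<in> balg_hom S A B"
  shows balg_hom_atoms: "\<And>x. x \<in> bcarr A \<Longrightarrow> at_below B (h x) = h ` at_below A x"
    and balg_hom_op: "\<And>\<sigma> xs. (\<sigma>, xs) \<in> op_dom S (bcarr A) \<Longrightarrow>
        h ` at_below A (bop A (\<sigma>, xs)) \<subseteq> at_below B (bop B (\<sigma>, map h xs))"
  using assms by (simp_all add: balg_hom_iff ordered_algebra_op ordered_algebra_order)

lemma balg_hom_minimal: "h \<in> balg_hom S A B \<Longrightarrow> x \<in> atoms A \<Longrightarrow> h x \<in> atoms B"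
  by (auto simp: balg_hom_def)

lemma balg_hom_id:
  assumes "ordered_algebra S A"
  shows "(\<lambda>x\<in>bcarr A. x) \<in> balg_hom S A A"
proof (rule balg_homI[OF assms assms])
  have im: "(\<lambda>x\<in>bcarr A. x) ` at_below A y = at_below A y" for y
    using at_below_subset_bcarr[of A y] by force
  show "at_below A ((\<lambda>x\<in>bcarr A. x) x) = (\<lambda>x\<in>bcarr A. x) ` at_below A x" if "x \<in> bcarr A" for x
    unfolding im using that by simp
  show "(\<lambda>x\<in>bcarr A. x) ` at_below A (bop A (\<sigma>, xs)) \<subseteq>
      at_below A (bop A (\<sigma>, map (\<lambda>x\<in>bcarr A. x) xs))" if "(\<sigma>, xs) \<in> op_dom S (bcarr A)" for \<sigma> xs
    unfolding im using op_domD[OF that] by (simp add: map_restrict)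
qed auto

text \<open>In the atom description all conditions concern images of atom sets, and these compose
  without any reference to suprema.\<close>

lemma balg_hom_compose:
  assumes A: "ordered_algebra S A" and B: "ordered_algebra S B" and C: "ordered_algebra S C"
    and f: "f \<in> balg_hom S A B" and g: "g \<in> balg_hom S B C"
  shows "compose (bcarr A) g f \<in> balg_hom S A C"
proof (rule balg_homI[OF A C])
  note fB = balg_hom_PiE[OF f] and gC = balg_hom_PiE[OF g]
  have im: "compose (bcarr A) g f ` at_below A x = g ` f ` at_below A x" for x
    using at_below_subset_bcarr[of A x] by (force simp: compose_def image_image)
  show "compose (bcarr A) g f \<in> bcarr A \<rightarrow>\<^sub>E bcarr C" using fB gC by (rule compose_in_PiE)
  show "at_below C (compose (bcarr A) g f x) = compose (bcarr A) g f ` at_below A x"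
    if "x \<in> bcarr A" for x
  proof -
    have "f x \<in> bcarr B" using fB that by auto
    then show ?thesis
      unfolding im using that balg_hom_atoms[OF A B f] balg_hom_atoms[OF B C g]
      by (simp add: compose_def)
  qed
  fix \<sigma> xs assume xs: "(\<sigma>, xs) \<in> op_dom S (bcarr A)"
  have "(\<sigma>, map f xs) \<in> op_dom S (bcarr B)" using fB by (intro op_dom_map[OF xs]) auto
  from balg_hom_op[OF B C g this] balg_hom_op[OF A B f xs]
  have "g ` f ` at_below A (bop A (\<sigma>, xs)) \<subseteq> at_below C (bop C (\<sigma>, map g (map f xs)))" by fast
  then show "compose (bcarr A) g f ` at_below A (bop A (\<sigma>, xs)) \<subseteq>
      at_below C (bop C (\<sigma>, map (compose (bcarr A) g f) xs))"
    unfolding im using op_domD[OF xs] by (simp add: map_compose)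
qed

lemma category_AlgB: "category (AlgB S)"
  unfolding category_def AlgB_simps mem_Collect_eq
  by (intro conjI ballI; unfold mem_Collect_eq)
    (rule balg_hom_id balg_hom_compose compose_restrict_id_left[OF balg_hom_PiE]
      compose_restrict_id_right[OF balg_hom_PiE] compose_compose[OF balg_hom_PiE]; assumption)+

section \<open>The functors\<close>

lemma P_alg_simps [simp]:
  "bcarr (P_alg S M) = Pow_ne (mcarr M)"
  "(X, Y) \<in> ble (P_alg S M) \<longleftrightarrow> X \<in> Pow_ne (mcarr M) \<and> Y \<in> Pow_ne (mcarr M) \<and> X \<subseteq> Y"
  by (simp_all add: P_alg_def)

lemma bop_P_alg:
  "(\<sigma>, Xs) \<in> op_dom S (Pow_ne (mcarr M)) \<Longrightarrow> bop (P_alg S M) (\<sigma>, Xs) = (\<Union>xs\<in>listset Xs. mop M (\<sigma>, xs))"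
  by (auto simp: P_alg_def)

lemma Pow_ne_image: "h ` A \<subseteq> B \<Longrightarrow> X \<in> Pow_ne A \<Longrightarrow> h ` X \<in> Pow_ne B"
  by (auto simp: Pow_ne_def)

lemma atoms_P_alg: "atoms (P_alg S M) = (\<lambda>x. {x}) ` mcarr M"
proof
  show "atoms (P_alg S M) \<subseteq> (\<lambda>x. {x}) ` mcarr M"
  proof
    fix X assume X: "X \<in> atoms (P_alg S M)"
    then obtain x where x: "x \<in> X" "x \<in> mcarr M" by (auto simp: minimals_def Pow_ne_def)
    then have "{x} = X" using X by (auto simp: minimals_def Pow_ne_def)
    then show "X \<in> (\<lambda>x. {x}) ` mcarr M" using x by auto
  qed
  show "(\<lambda>x. {x}) ` mcarr M \<subseteq> atoms (P_alg S M)"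
    by (auto simp: minimals_def Pow_ne_def)
qed

lemma at_below_P_alg: "X \<in> Pow_ne (mcarr M) \<Longrightarrow> at_below (P_alg S M) X = (\<lambda>x. {x}) ` X"
  unfolding atoms_below_def atoms_P_alg by (auto simp: Pow_ne_def)

text \<open>Here \<open>at_below\<close> is the image under the singleton map, and this injective
  map identifies the non-empty subsets of \<open>mcarr M\<close> with the non-empty sets of
  atoms.\<close>

lemma powerset_order_P_alg:
  assumes "mcarr M \<noteq> {}"
  shows "powerset_order (ord_of (P_alg S M))"
proof unfold_locales
  have "at_below (P_alg S M) ` Pow_ne (mcarr M) = (\<lambda>X. (\<lambda>x. {x}) ` X) ` Pow_ne (mcarr M)"
    by (rule image_cong[OF refl at_below_P_alg])
  also have "\<dots> = Pow_ne ((\<lambda>x. {x}) ` mcarr M)"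
    \<comment> \<open>The image map sends the powerset onto the powerset of the image, and only the
      empty set has an empty image.\<close>
    unfolding Pow_ne_def image_Pow_surj[OF refl, symmetric] by auto
  finally show "at_below (P_alg S M) ` carrier (ord_of (P_alg S M)) = Pow_ne (atoms (P_alg S M))"
    unfolding atoms_P_alg by simp
qed (use assms in \<open>auto simp: atoms_P_alg at_below_P_alg\<close>)

lemma op_dom_Pow_ne_listset:
  assumes "(\<sigma>, Xs) \<in> op_dom S (Pow_ne A)" "xs \<in> listset Xs"
  shows "(\<sigma>, xs) \<in> op_dom S A"
  using op_dom_listset[of \<sigma> Xs S "Pow_ne A" xs "\<lambda>X. X" A] assms by (auto simp: Pow_ne_def)

text \<open>Choosing atoms below the entries of \<open>Xs\<close> amounts to choosing elements of
  the entries, and on singletons the powerset operation returns a value of \<open>mop M\<close>. The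
  supremum law then says that taking images commutes with unions.\<close>

lemma ordered_algebra_P_alg:
  assumes M: "multialgebra S M"
  shows "ordered_algebra S (P_alg S M)"
  unfolding ordered_algebra_iff
proof (intro conjI allI impI)
  have cl: "bop (P_alg S M) (\<sigma>, Xs) \<in> Pow_ne (mcarr M)"
    if Xs: "(\<sigma>, Xs) \<in> op_dom S (Pow_ne (mcarr M))" for \<sigma> Xs
  proof -
    \<comment> \<open>All entries are non-empty, so the union has at least one term, and each term
      is non-empty.\<close>
    have "listset Xs \<noteq> {}" using op_domD[OF Xs] by (intro listset_nonempty) (auto simp: Pow_ne_def)
    then obtain xs where xs: "xs \<in> listset Xs" by auto
    have "mop M (\<sigma>, xs) \<noteq> {}"
      by (rule multialgebra_mop_nonempty[OF M op_dom_Pow_ne_listset[OF Xs xs]])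
    moreover have "(\<Union>xs\<in>listset Xs. mop M (\<sigma>, xs)) \<subseteq> mcarr M"
      by (intro UN_least multialgebra_mop_subset[OF M op_dom_Pow_ne_listset[OF Xs]])
    ultimately show ?thesis
      unfolding bop_P_alg[OF Xs] Pow_ne_def using xs by auto
  qed
  show "bop (P_alg S M) \<in> op_dom S (bcarr (P_alg S M)) \<rightarrow>\<^sub>E bcarr (P_alg S M)"
  proof (rule PiE_I)
    show "bop (P_alg S M) x \<in> bcarr (P_alg S M)" if "x \<in> op_dom S (bcarr (P_alg S M))" for x
      using that cl by (cases x) simp
  qed (simp add: P_alg_def)
  show "ble (P_alg S M) \<subseteq> bcarr (P_alg S M) \<times> bcarr (P_alg S M)"
    by auto
  show "powerset_order (ord_of (P_alg S M))"
    using M by (intro powerset_order_P_alg) (simp add: multialgebra_def)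
  fix \<sigma> Xs assume "(\<sigma>, Xs) \<in> op_dom S (bcarr (P_alg S M))"
  then have Xs: "(\<sigma>, Xs) \<in> op_dom S (Pow_ne (mcarr M))" by simp
  have "map (at_below (P_alg S M)) Xs = map ((`) (\<lambda>x. {x})) Xs"
    using op_domD[OF Xs] by (auto simp: at_below_P_alg)
  then have l: "listset (map (at_below (P_alg S M)) Xs) = map (\<lambda>x. {x}) ` listset Xs"
    by (simp only: listset_map_image)
  have *: "at_below (P_alg S M) (bop (P_alg S M) (\<sigma>, map (\<lambda>x. {x}) xs)) = (\<lambda>x. {x}) ` mop M (\<sigma>, xs)"
    if "xs \<in> listset Xs" for xs
  proof -
    have "(\<sigma>, map (\<lambda>x. {x}) xs) \<in> op_dom S (Pow_ne (mcarr M))"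
      by (rule op_dom_map[OF op_dom_Pow_ne_listset[OF Xs that]]) (auto simp: Pow_ne_def)
    from at_below_P_alg[OF cl[OF this]] bop_P_alg[OF this] show ?thesis
      by (simp add: listset_map_singleton)
  qed
  have "at_below (P_alg S M) (bop (P_alg S M) (\<sigma>, Xs)) = (\<lambda>x. {x}) ` bop (P_alg S M) (\<sigma>, Xs)"
    by (rule at_below_P_alg[OF cl[OF Xs]])
  also have "\<dots> = (\<Union>xs\<in>listset Xs. (\<lambda>x. {x}) ` mop M (\<sigma>, xs))"
    unfolding bop_P_alg[OF Xs] by (rule image_UN)
  also have "\<dots> = (\<Union>ys\<in>listset (map (at_below (P_alg S M)) Xs). at_below (P_alg S M) (bop (P_alg S M) (\<sigma>, ys)))"
    unfolding l by (simp add: *)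
  finally show "at_below (P_alg S M) (bop (P_alg S M) (\<sigma>, Xs)) =
      (\<Union>ys\<in>listset (map (at_below (P_alg S M)) Xs). at_below (P_alg S M) (bop (P_alg S M) (\<sigma>, ys)))" .
qed

lemma P_ftor_hom:
  assumes M: "multialgebra S M" and N: "multialgebra S N" and h: "h \<in> malg_hom S M N"
  shows "(\<lambda>X\<in>Pow_ne (mcarr M). h ` X) \<in> balg_hom S (P_alg S M) (P_alg S N)"
    (is "?h \<in> _")
proof (rule balg_homI[OF ordered_algebra_P_alg[OF M] ordered_algebra_P_alg[OF N]])
  have hN: "h ` mcarr M \<subseteq> mcarr N" using malg_hom_PiE[OF h] by auto
  show "?h \<in> bcarr (P_alg S M) \<rightarrow>\<^sub>E bcarr (P_alg S N)"
    using Pow_ne_image[OF hN] by auto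
  \<comment> \<open>The direct image sends \<open>{x}\<close> to \<open>{h x}\<close>, so atoms go
    to atoms.\<close>
  have im: "?h ` (\<lambda>x. {x}) ` X = (\<lambda>x. {x}) ` h ` X" if "X \<subseteq> mcarr M" for X
    unfolding image_image using that by (intro image_cong refl) (auto simp: Pow_ne_def)
  show "at_below (P_alg S N) (?h X) = ?h ` at_below (P_alg S M) X" if "X \<in> bcarr (P_alg S M)" for X
  proof -
    have X: "X \<in> Pow_ne (mcarr M)" using that by simp
    have "h ` X \<in> Pow_ne (mcarr N)" using Pow_ne_image[OF hN X] .
    moreover have "X \<subseteq> mcarr M" using X by (simp add: Pow_ne_def)
    ultimately show ?thesis
      using X im[of X] by (simp add: at_below_P_alg)
  qed
  fix \<sigma> Xs assume d: "(\<sigma>, Xs) \<in> op_dom S (bcarr (P_alg S M))"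
  then have Xs: "(\<sigma>, Xs) \<in> op_dom S (Pow_ne (mcarr M))" by simp
  have hXs: "(\<sigma>, map ((`) h) Xs) \<in> op_dom S (Pow_ne (mcarr N))"
    using Pow_ne_image[OF hN] by (intro op_dom_map[OF Xs]) auto
  have mp: "map ?h Xs = map ((`) h) Xs" using op_domD[OF Xs] by (simp add: map_restrict)
  have c: "bop (P_alg S M) (\<sigma>, Xs) \<in> Pow_ne (mcarr M)"
    using ordered_algebra_bop[OF ordered_algebra_P_alg[OF M] d] by simp
  have c': "bop (P_alg S N) (\<sigma>, map ((`) h) Xs) \<in> Pow_ne (mcarr N)"
    using ordered_algebra_bop[OF ordered_algebra_P_alg[OF N], of \<sigma> "map ((`) h) Xs"] hXs by simp
  have "h ` mop M (\<sigma>, xs) \<subseteq> mop N (\<sigma>, map h xs)" if "xs \<in> listset Xs" for xs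
    using h op_dom_Pow_ne_listset[OF Xs that] unfolding malg_hom_iff by blast
  \<comment> \<open>Tuples chosen from the images are the images of tuples chosen from
    \<open>Xs\<close>, so the inclusion holds term by term.\<close>
  then have "h ` bop (P_alg S M) (\<sigma>, Xs) \<subseteq> bop (P_alg S N) (\<sigma>, map ((`) h) Xs)"
    unfolding bop_P_alg[OF Xs] bop_P_alg[OF hXs] listset_map_image by auto
  moreover have "bop (P_alg S M) (\<sigma>, Xs) \<subseteq> mcarr M" using c by (simp add: Pow_ne_def)
  ultimately show "?h ` at_below (P_alg S M) (bop (P_alg S M) (\<sigma>, Xs)) \<subseteq>
      at_below (P_alg S N) (bop (P_alg S N) (\<sigma>, map ?h Xs))"
    unfolding mp at_below_P_alg[OF c] at_below_P_alg[OF c'] by (simp only: im image_mono)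
qed

lemma P_ftor_simps [simp]:
  "fobj (P_ftor S) = P_alg S"
  "farr (P_ftor S) M N h = (\<lambda>X\<in>Pow_ne (mcarr M). h ` X)"
  by (simp_all add: P_ftor_def)

lemma A_ftor_simps [simp]:
  "fobj (A_ftor S) = A_malg S"
  "farr (A_ftor S) A B h = restrict h (atoms A)"
  by (simp_all add: A_ftor_def)

lemma is_functor_P_ftor:
  fixes S :: "nat \<Rightarrow> 's set"
  shows "is_functor (MAlg S) (AlgB S)
    (P_ftor S :: (('s, 'a) malg, 'a \<Rightarrow> 'a, ('s, 'a set) balg, 'a set \<Rightarrow> 'a set) ftor)"
  unfolding is_functor_def
proof (intro conjI ballI category_MAlg category_AlgB)
  fix M :: "('s, 'a) malg" assume "M \<in> Obj (MAlg S)"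
  then show "fobj (P_ftor S) M \<in> Obj (AlgB S)" by (simp add: ordered_algebra_P_alg)
next
  fix M N :: "('s, 'a) malg" and h
  assume "M \<in> Obj (MAlg S)" "N \<in> Obj (MAlg S)" "h \<in> Hom (MAlg S) M N"
  then show "farr (P_ftor S) M N h \<in> Hom (AlgB S) (fobj (P_ftor S) M) (fobj (P_ftor S) N)"
    by (simp add: P_ftor_hom)
next
  fix M :: "('s, 'a) malg"
  have "(\<lambda>x\<in>mcarr M. x) ` X = X" if "X \<in> Pow_ne (mcarr M)" for X
    using that by (force simp: Pow_ne_def)
  then show "farr (P_ftor S) M M (Ident (MAlg S) M) = Ident (AlgB S) (fobj (P_ftor S) M)"
    by (auto simp: fun_eq_iff)
next
  fix M N P :: "('s, 'a) malg" and f g :: "'a \<Rightarrow> 'a"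
  assume "f \<in> Hom (MAlg S) M N"
  then have f: "f ` mcarr M \<subseteq> mcarr N" by (auto dest: malg_hom_PiE)
  have "compose (mcarr M) g f ` X = g ` f ` X" if "X \<in> Pow_ne (mcarr M)" for X
    unfolding image_image using that by (intro image_cong refl) (auto simp: Pow_ne_def compose_def)
  then show "farr (P_ftor S) M P (Comp (MAlg S) M N P g f) =
      Comp (AlgB S) (fobj (P_ftor S) M) (fobj (P_ftor S) N) (fobj (P_ftor S) P)
        (farr (P_ftor S) N P g) (farr (P_ftor S) M N f)"
    using Pow_ne_image[OF f] by (auto simp: fun_eq_iff compose_def)
qed

section \<open>The functor of atoms\<close>

lemma A_malg_simps [simp]:
  "mcarr (A_malg S B) = atoms B"
  "(\<sigma>, xs) \<in> op_dom S (atoms B) \<Longrightarrow> mop (A_malg S B) (\<sigma>, xs) = at_below B (bop B (\<sigma>, xs))"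
  by (simp_all add: A_malg_def)

lemma op_dom_atoms: "(\<sigma>, xs) \<in> op_dom S (atoms B) \<Longrightarrow> (\<sigma>, xs) \<in> op_dom S (bcarr B)"
  using atoms_subset_bcarr[of B] by (auto simp: op_dom_def)

lemma image_restrict_at_below: "restrict h (atoms A) ` at_below A x = h ` at_below A x"
  using atoms_below_subset[of "ord_of A" x] by (intro image_cong refl) auto

lemma at_below_in_Pow_ne: "ordered_algebra S A \<Longrightarrow> x \<in> bcarr A \<Longrightarrow> at_below A x \<in> Pow_ne (atoms A)"
  using powerset_order.atoms_below_nonempty[OF ordered_algebra_order, of S A x]
    atoms_below_subset[of "ord_of A" x] by (simp add: Pow_ne_def)

text \<open>The values are non-empty because without a bottom every element has an atom below
  it.\<close>

lemma multialgebra_A_malg: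
  assumes B: "ordered_algebra S B"
  shows "multialgebra S (A_malg S B)"
proof -
  interpret powerset_order "ord_of B" by (rule ordered_algebra_order[OF B])
  have "at_below B (bop B (\<sigma>, xs)) \<in> Pow_ne (atoms B)" if "(\<sigma>, xs) \<in> op_dom S (atoms B)" for \<sigma> xs
    by (rule at_below_in_Pow_ne[OF B ordered_algebra_bop[OF B op_dom_atoms[OF that]]])
  then show ?thesis
    using minimals_nonempty by (auto simp: multialgebra_def A_malg_def)
qed

text \<open>At tuples of atoms, the operation condition of \<open>balg_hom_iff\<close> is already
  the inclusion between values of the multioperations.\<close>

lemma A_ftor_hom:
  assumes A: "ordered_algebra S A" and B: "ordered_algebra S B" and h: "h \<in> balg_hom S A B"
  shows "restrict h (atoms A) \<in> malg_hom S (A_malg S A) (A_malg S B)"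
  unfolding malg_hom_iff
proof (intro conjI allI impI)
  show "restrict h (atoms A) \<in> mcarr (A_malg S A) \<rightarrow>\<^sub>E mcarr (A_malg S B)"
    using balg_hom_minimal[OF h] by auto
  fix \<sigma> xs assume "(\<sigma>, xs) \<in> op_dom S (mcarr (A_malg S A))"
  then have xs: "(\<sigma>, xs) \<in> op_dom S (atoms A)" by simp
  have hxs: "(\<sigma>, map h xs) \<in> op_dom S (atoms B)"
    using balg_hom_minimal[OF h] by (intro op_dom_map[OF xs]) auto
  have mp: "map (restrict h (atoms A)) xs = map h xs" using op_domD[OF xs] by (simp add: map_restrict)
  show "restrict h (atoms A) ` mop (A_malg S A) (\<sigma>, xs) \<subseteq>
      mop (A_malg S B) (\<sigma>, map (restrict h (atoms A)) xs)"
    unfolding mp A_malg_simps(2)[OF xs] A_malg_simps(2)[OF hxs] image_restrict_at_below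
    by (rule balg_hom_op[OF A B h op_dom_atoms[OF xs]])
qed

lemma is_functor_A_ftor:
  fixes S :: "nat \<Rightarrow> 's set"
  shows "is_functor (AlgB S) (MAlg S) (A_ftor S :: (('s, 'a) balg, 'a \<Rightarrow> 'a, ('s, 'a) malg, 'a \<Rightarrow> 'a) ftor)"
  unfolding is_functor_def
proof (intro conjI ballI category_MAlg category_AlgB)
  fix A :: "('s, 'a) balg" assume "A \<in> Obj (AlgB S)"
  then show "fobj (A_ftor S) A \<in> Obj (MAlg S)" by (simp add: multialgebra_A_malg)
next
  fix A B :: "('s, 'a) balg" and h
  assume "A \<in> Obj (AlgB S)" "B \<in> Obj (AlgB S)" "h \<in> Hom (AlgB S) A B"
  then show "farr (A_ftor S) A B h \<in> Hom (MAlg S) (fobj (A_ftor S) A) (fobj (A_ftor S) B)"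
    by (simp add: A_ftor_hom)
next
  fix A :: "('s, 'a) balg"
  show "farr (A_ftor S) A A (Ident (AlgB S) A) = Ident (MAlg S) (fobj (A_ftor S) A)"
    using atoms_subset_bcarr[of A] by (auto simp: fun_eq_iff)
next
  fix A B C :: "('s, 'a) balg" and f g :: "'a \<Rightarrow> 'a"
  assume "f \<in> Hom (AlgB S) A B"
  then show "farr (A_ftor S) A C (Comp (AlgB S) A B C g f) =
      Comp (MAlg S) (fobj (A_ftor S) A) (fobj (A_ftor S) B) (fobj (A_ftor S) C)
        (farr (A_ftor S) B C g) (farr (A_ftor S) A B f)"
    using atoms_subset_bcarr[of A] by (auto simp: fun_eq_iff compose_def dest: balg_hom_minimal)
qed

section \<open>Isomorphisms\<close>

text \<open>Morphisms are extensional, so an inverse has to be cut off to \<open>B\<close> before it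
  can serve as a morphism.\<close>

lemma bij_betw_inverse_compose:
  assumes bij: "bij_betw f A B" and f: "f \<in> extensional A"
  defines "g \<equiv> restrict (inv_into A f) B"
  shows "compose A g f = (\<lambda>x\<in>A. x)" and "compose B f g = (\<lambda>x\<in>B. x)"
    and "g \<in> B \<rightarrow>\<^sub>E A" and "bij_betw g B A"
proof -
  have fB: "f x \<in> B" if "x \<in> A" for x using bij that by (auto simp: bij_betw_def)
  have gA: "inv_into A f y \<in> A" if "y \<in> B" for y
    using bij that by (auto simp: bij_betw_def intro: inv_into_into)
  show "compose A g f = (\<lambda>x\<in>A. x)"
    using bij fB by (auto simp: compose_def fun_eq_iff g_def bij_betw_inv_into_left)
  show "compose B f g = (\<lambda>x\<in>B. x)"
    using bij by (auto simp: compose_def fun_eq_iff g_def bij_betw_inv_into_right)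
  show "g \<in> B \<rightarrow>\<^sub>E A" using gA by (auto simp: g_def)
  show "bij_betw g B A"
    unfolding g_def using bij_betw_inv_into[OF bij] by (simp cong: bij_betw_cong)
qed

lemma map_inverse:
  assumes "compose B f g = (\<lambda>x\<in>B. x)" "set xs \<subseteq> B"
  shows "map f (map g xs) = xs"
  using assms map_compose[of xs B f g] by (simp add: map_restrict)

lemma image_inverse:
  assumes "compose A g f = (\<lambda>x\<in>A. x)" "X \<subseteq> A"
  shows "g ` f ` X = X"
proof -
  have "g (f x) = x" if "x \<in> X" for x
    using fun_cong[OF assms(1), of x] assms(2) that by (auto simp: compose_def)
  then show ?thesis by (auto simp: image_image)
qed

text \<open>Inclusion in \<open>op\<close> would only make \<open>f\<close> a homomorphism. Equality
  can be read backwards along the inverse and makes that a homomorphism too.\<close>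

lemma malg_isoI:
  assumes M: "multialgebra S M"
    and f: "f \<in> extensional (mcarr M)" and bij: "bij_betw f (mcarr M) (mcarr N)"
    and op: "\<And>\<sigma> xs. (\<sigma>, xs) \<in> op_dom S (mcarr M) \<Longrightarrow> mop N (\<sigma>, map f xs) = f ` mop M (\<sigma>, xs)"
  shows "malg_iso S M N f"
proof -
  define g where "g = restrict (inv_into (mcarr M) f) (mcarr N)"
  note g = bij_betw_inverse_compose[OF bij f, folded g_def]
  have "f \<in> mcarr M \<rightarrow>\<^sub>E mcarr N" using f bij by (auto simp: bij_betw_def PiE_def)
  then have "f \<in> malg_hom S M N" using op by (simp add: malg_hom_iff)
  moreover have "g \<in> malg_hom S N M"
    unfolding malg_hom_iff
  proof (intro conjI allI impI)
    show "g \<in> mcarr N \<rightarrow>\<^sub>E mcarr M" by (rule g)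
    fix \<sigma> ys assume ys: "(\<sigma>, ys) \<in> op_dom S (mcarr N)"
    have gys: "(\<sigma>, map g ys) \<in> op_dom S (mcarr M)" using g(3) by (intro op_dom_map[OF ys]) auto
    have "map f (map g ys) = ys" using op_domD[OF ys] by (intro map_inverse[OF g(2)]) simp
    with op[OF gys] have "g ` mop N (\<sigma>, ys) = g ` f ` mop M (\<sigma>, map g ys)" by simp
    also have "\<dots> = mop M (\<sigma>, map g ys)"
      by (rule image_inverse[OF g(1) multialgebra_mop_subset[OF M gys]])
    finally show "g ` mop N (\<sigma>, ys) \<subseteq> mop M (\<sigma>, map g ys)" by simp
  qed
  ultimately show ?thesis using g unfolding malg_iso_def by blast
qed

text \<open>An order isomorphism carries atoms below \<open>x\<close> to atoms below
  \<open>f x\<close>, which covers suprema and minimal elements; only the operations need a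
  hypothesis of their own.\<close>

lemma balg_order_iso_hom:
  assumes A: "ordered_algebra S A" and B: "ordered_algebra S B"
    and f: "f \<in> extensional (bcarr A)" and bij: "bij_betw f (bcarr A) (bcarr B)"
    and le: "\<And>x y. x \<in> bcarr A \<Longrightarrow> y \<in> bcarr A \<Longrightarrow> (f x, f y) \<in> ble B \<longleftrightarrow> (x, y) \<in> ble A"
    and op: "\<And>\<sigma> xs. (\<sigma>, xs) \<in> op_dom S (bcarr A) \<Longrightarrow> bop B (\<sigma>, map f xs) = f (bop A (\<sigma>, xs))"
  shows "f \<in> balg_hom S A B"
proof (rule balg_homI[OF A B])
  show "f \<in> bcarr A \<rightarrow>\<^sub>E bcarr B" using f bij by (auto simp: bij_betw_def PiE_def)
  show at: "at_below B (f x) = f ` at_below A x" if "x \<in> bcarr A" for x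
    using order_iso_atoms_below[of f "ord_of A" "ord_of B" x] bij le that by simp
  fix \<sigma> xs assume xs: "(\<sigma>, xs) \<in> op_dom S (bcarr A)"
  show "f ` at_below A (bop A (\<sigma>, xs)) \<subseteq> at_below B (bop B (\<sigma>, map f xs))"
    unfolding op[OF xs] at[OF ordered_algebra_bop[OF A xs]] ..
qed

text \<open>The hypotheses on order and operations are symmetric, so the inverse satisfies them too
  and \<open>balg_order_iso_hom\<close> applies to both maps.\<close>

lemma balg_isoI:
  assumes A: "ordered_algebra S A" and B: "ordered_algebra S B"
    and f: "f \<in> extensional (bcarr A)" and bij: "bij_betw f (bcarr A) (bcarr B)"
    and le: "\<And>x y. x \<in> bcarr A \<Longrightarrow> y \<in> bcarr A \<Longrightarrow> (f x, f y) \<in> ble B \<longleftrightarrow> (x, y) \<in> ble A"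
    and op: "\<And>\<sigma> xs. (\<sigma>, xs) \<in> op_dom S (bcarr A) \<Longrightarrow> bop B (\<sigma>, map f xs) = f (bop A (\<sigma>, xs))"
  shows "balg_iso S A B f"
proof -
  define g where "g = restrict (inv_into (bcarr A) f) (bcarr B)"
  note g = bij_betw_inverse_compose[OF bij f, folded g_def]
  have gA: "g y \<in> bcarr A" if "y \<in> bcarr B" for y using g(3) that by auto
  have fg: "f (g y) = y" if "y \<in> bcarr B" for y
    using fun_cong[OF g(2), of y] that by (simp add: compose_def)
  have gf: "g (f x) = x" if "x \<in> bcarr A" for x
    using fun_cong[OF g(1), of x] that by (simp add: compose_def)
  have "g \<in> balg_hom S B A"
  proof (rule balg_order_iso_hom[OF B A _ g(4)])
    show "g \<in> extensional (bcarr B)" by (simp add: g_def)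
    show "(g x, g y) \<in> ble A \<longleftrightarrow> (x, y) \<in> ble B" if "x \<in> bcarr B" "y \<in> bcarr B" for x y
      using le[of "g x" "g y"] that gA fg by simp
    fix \<sigma> ys assume ys: "(\<sigma>, ys) \<in> op_dom S (bcarr B)"
    have gys: "(\<sigma>, map g ys) \<in> op_dom S (bcarr A)" using gA by (intro op_dom_map[OF ys]) auto
    have "map f (map g ys) = ys" using op_domD[OF ys] by (intro map_inverse[OF g(2)]) simp
    with op[OF gys] have "bop B (\<sigma>, ys) = f (bop A (\<sigma>, map g ys))" by simp
    then show "bop A (\<sigma>, map g ys) = g (bop B (\<sigma>, ys))"
      using gf[OF ordered_algebra_bop[OF A gys]] by simp
  qed
  then show ?thesis
    using g balg_order_iso_hom[OF A B f bij le op] unfolding balg_iso_def by blast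
qed

text \<open>Exchanging the roles of the maps gives the other inverse law, so this one statement
  serves both laws for both kinds of algebra.\<close>

lemma compose_inverse:
  assumes "f \<in> A \<rightarrow>\<^sub>E B" "g \<in> B \<rightarrow>\<^sub>E C" "g' \<in> C \<rightarrow>\<^sub>E B" "f' \<in> B \<rightarrow>\<^sub>E A"
    and "compose A f' f = (\<lambda>x\<in>A. x)" "compose B g' g = (\<lambda>x\<in>B. x)"
  shows "compose A (compose C f' g') (compose A g f) = (\<lambda>x\<in>A. x)"
proof
  fix x
  show "compose A (compose C f' g') (compose A g f) x = (\<lambda>x\<in>A. x) x"
  proof (cases "x \<in> A")
    case True
    then have fx: "f x \<in> B" using assms(1) by auto
    then have "g (f x) \<in> C" using assms(2) by auto
    moreover have "f' (f x) = x" using fun_cong[OF assms(5), of x] True by (simp add: compose_def)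
    moreover have "g' (g (f x)) = f x"
      using fun_cong[OF assms(6), of "f x"] fx by (simp add: compose_def)
    ultimately show ?thesis using True by (simp add: compose_def)
  qed (simp add: compose_def)
qed

lemma malg_iso_compose:
  assumes M: "multialgebra S M" and P: "multialgebra S P"
    and f: "malg_iso S M N f" and g: "malg_iso S N P g"
  shows "malg_iso S M P (compose (mcarr M) g f)"
proof -
  obtain f' where f': "f' \<in> malg_hom S N M" "compose (mcarr M) f' f = (\<lambda>x\<in>mcarr M. x)"
    "compose (mcarr N) f f' = (\<lambda>x\<in>mcarr N. x)" and f: "f \<in> malg_hom S M N"
    using f unfolding malg_iso_def by blast
  obtain g' where g': "g' \<in> malg_hom S P N" "compose (mcarr N) g' g = (\<lambda>x\<in>mcarr N. x)"
    "compose (mcarr P) g g' = (\<lambda>x\<in>mcarr P. x)" and g: "g \<in> malg_hom S N P"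
    using g unfolding malg_iso_def by blast
  note PiE = malg_hom_PiE[OF f] malg_hom_PiE[OF f'(1)] malg_hom_PiE[OF g] malg_hom_PiE[OF g'(1)]
  show ?thesis
    unfolding malg_iso_def
    using malg_hom_compose[OF M f g] malg_hom_compose[OF P g'(1) f'(1)]
      compose_inverse[OF PiE(1,3,4,2) f'(2) g'(2)] compose_inverse[OF PiE(4,2,1,3) g'(3) f'(3)]
    by blast
qed

lemma balg_iso_compose:
  assumes A: "ordered_algebra S A" and B: "ordered_algebra S B" and C: "ordered_algebra S C"
    and f: "balg_iso S A B f" and g: "balg_iso S B C g"
  shows "balg_iso S A C (compose (bcarr A) g f)"
proof -
  obtain f' where f': "f' \<in> balg_hom S B A" "compose (bcarr A) f' f = (\<lambda>x\<in>bcarr A. x)"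
    "compose (bcarr B) f f' = (\<lambda>x\<in>bcarr B. x)" and f: "f \<in> balg_hom S A B"
    using f unfolding balg_iso_def by blast
  obtain g' where g': "g' \<in> balg_hom S C B" "compose (bcarr B) g' g = (\<lambda>x\<in>bcarr B. x)"
    "compose (bcarr C) g g' = (\<lambda>x\<in>bcarr C. x)" and g: "g \<in> balg_hom S B C"
    using g unfolding balg_iso_def by blast
  note PiE = balg_hom_PiE[OF f] balg_hom_PiE[OF f'(1)] balg_hom_PiE[OF g] balg_hom_PiE[OF g'(1)]
  show ?thesis
    unfolding balg_iso_def
    using balg_hom_compose[OF A B C f g] balg_hom_compose[OF C B A g'(1) f'(1)]
      compose_inverse[OF PiE(1,3,4,2) f'(2) g'(2)] compose_inverse[OF PiE(4,2,1,3) g'(3) f'(3)]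
    by blast
qed

text \<open>Functors preserve isomorphisms; the argument is repeated here because \<open>A\<close>
  and \<open>B\<close> may live over different types and so need not be objects of one
  \<open>cat\<close>.\<close>

lemma A_ftor_iso:
  assumes A: "ordered_algebra S A" and B: "ordered_algebra S B" and f: "balg_iso S A B f"
  shows "malg_iso S (A_malg S A) (A_malg S B) (restrict f (atoms A))"
proof -
  obtain g where f: "f \<in> balg_hom S A B" and g: "g \<in> balg_hom S B A"
    and gf: "compose (bcarr A) g f = (\<lambda>x\<in>bcarr A. x)" and fg: "compose (bcarr B) f g = (\<lambda>x\<in>bcarr B. x)"
    using f unfolding balg_iso_def by blast
  have 1: "g (f x) = x" if "x \<in> atoms A" for x
    using fun_cong[OF gf, of x] that atoms_subset_bcarr[of A] by (auto simp: compose_def)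
  have 2: "f (g y) = y" if "y \<in> atoms B" for y
    using fun_cong[OF fg, of y] that atoms_subset_bcarr[of B] by (auto simp: compose_def)
  have "compose (atoms A) (restrict g (atoms B)) (restrict f (atoms A)) = (\<lambda>x\<in>atoms A. x)"
    using 1 balg_hom_minimal[OF f] by (auto simp: compose_def fun_eq_iff)
  moreover have "compose (atoms B) (restrict f (atoms A)) (restrict g (atoms B)) = (\<lambda>x\<in>atoms B. x)"
    using 2 balg_hom_minimal[OF g] by (auto simp: compose_def fun_eq_iff)
  ultimately show ?thesis
    unfolding malg_iso_def A_malg_simps using A_ftor_hom[OF A B f] A_ftor_hom[OF B A g] by blast
qed

text \<open>At a tuple of singletons the union defining the powerset operation has the single term
  \<open>mop M (\<sigma>, xs)\<close>, and the atoms below that set are its singletons. This gives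
  the equation that \<open>malg_isoI\<close> requires.\<close>

lemma malg_iso_singleton:
  assumes M: "multialgebra S M"
  shows "malg_iso S M (A_malg S (P_alg S M)) (\<lambda>x\<in>mcarr M. {x})"
proof (rule malg_isoI[OF M])
  show "bij_betw (\<lambda>x\<in>mcarr M. {x}) (mcarr M) (mcarr (A_malg S (P_alg S M)))"
    by (auto simp: bij_betw_def inj_on_def atoms_P_alg)
  fix \<sigma> xs assume xs: "(\<sigma>, xs) \<in> op_dom S (mcarr M)"
  have d: "(\<sigma>, map (\<lambda>x. {x}) xs) \<in> op_dom S (atoms (P_alg S M))"
    by (rule op_dom_map[OF xs]) (simp add: atoms_P_alg)
  have d': "(\<sigma>, map (\<lambda>x. {x}) xs) \<in> op_dom S (Pow_ne (mcarr M))"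
    using op_dom_atoms[OF d] by simp
  have b: "bop (P_alg S M) (\<sigma>, map (\<lambda>x. {x}) xs) = mop M (\<sigma>, xs)"
    by (simp add: bop_P_alg[OF d'] listset_map_singleton)
  have "mop M (\<sigma>, xs) \<in> Pow_ne (mcarr M)"
    using multialgebra_mop_subset[OF M xs] multialgebra_mop_nonempty[OF M xs] by (simp add: Pow_ne_def)
  note c = at_below_P_alg[OF this]
  have "map (\<lambda>x\<in>mcarr M. {x}) xs = map (\<lambda>x. {x}) xs" using op_domD[OF xs] by (simp add: map_restrict)
  then have "mop (A_malg S (P_alg S M)) (\<sigma>, map (\<lambda>x\<in>mcarr M. {x}) xs) = (\<lambda>x. {x}) ` mop M (\<sigma>, xs)"
    by (simp only: A_malg_simps(2)[OF d] b c)
  also have "\<dots> = (\<lambda>x\<in>mcarr M. {x}) ` mop M (\<sigma>, xs)"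
    using multialgebra_mop_subset[OF M xs] by (intro image_cong refl) auto
  finally show "mop (A_malg S (P_alg S M)) (\<sigma>, map (\<lambda>x\<in>mcarr M. {x}) xs) = (\<lambda>x\<in>mcarr M. {x}) ` mop M (\<sigma>, xs)" .
qed simp

text \<open>Bijectivity and the order condition are the content of \<open>powerset_order\<close>;
  preservation of the operations is the supremum law in its atom form.\<close>

lemma balg_iso_at_below:
  assumes B: "ordered_algebra S B"
  shows "balg_iso S B (P_alg S (A_malg S B)) (restrict (at_below B) (bcarr B))"
proof (rule balg_isoI[OF B ordered_algebra_P_alg[OF multialgebra_A_malg[OF B]]])
  interpret powerset_order "ord_of B" by (rule ordered_algebra_order[OF B])
  show "bij_betw (restrict (at_below B) (bcarr B)) (bcarr B) (bcarr (P_alg S (A_malg S B)))"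
    using atoms_below_bij unfolding ord_of_simps P_alg_simps A_malg_simps by (simp cong: bij_betw_cong)
  note mem = at_below_in_Pow_ne[OF B]
  show "(restrict (at_below B) (bcarr B) x, restrict (at_below B) (bcarr B) y) \<in> ble (P_alg S (A_malg S B))
      \<longleftrightarrow> (x, y) \<in> ble B" if "x \<in> bcarr B" "y \<in> bcarr B" for x y
    using le_iff[of x y] that mem by simp
  fix \<sigma> xs assume xs: "(\<sigma>, xs) \<in> op_dom S (bcarr B)"
  have mp: "map (restrict (at_below B) (bcarr B)) xs = map (at_below B) xs"
    using op_domD[OF xs] by (simp add: map_restrict)
  have d: "(\<sigma>, map (at_below B) xs) \<in> op_dom S (Pow_ne (mcarr (A_malg S B)))"
    using mem by (intro op_dom_map[OF xs]) auto
  have "bop (P_alg S (A_malg S B)) (\<sigma>, map (at_below B) xs) =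
      (\<Union>ys\<in>listset (map (at_below B) xs). mop (A_malg S B) (\<sigma>, ys))"
    by (rule bop_P_alg[OF d])
  also have "\<dots> = (\<Union>ys\<in>listset (map (at_below B) xs). at_below B (bop B (\<sigma>, ys)))"
    using op_dom_Pow_ne_listset[OF d] by (intro SUP_cong HOL.refl A_malg_simps(2)) simp
  \<comment> \<open>Here the determination of the operations by their values on atoms
    enters.\<close>
  also have "\<dots> = at_below B (bop B (\<sigma>, xs))"
    by (rule ordered_algebra_atoms[OF B xs, symmetric])
  finally show "bop (P_alg S (A_malg S B)) (\<sigma>, map (restrict (at_below B) (bcarr B)) xs) =
      restrict (at_below B) (bcarr B) (bop B (\<sigma>, xs))"
    unfolding mp using ordered_algebra_bop[OF B xs] by simp
qed simp

section \<open>Transport of ordered algebras along an injection\<close>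

lemma relabel_balg_simps [simp]:
  "bcarr (relabel_balg c S B) = c ` bcarr B"
  by (simp add: relabel_balg_def)

lemma bop_relabel_balg:
  assumes inj: "inj_on c (bcarr B)" and xs: "(\<sigma>, xs) \<in> op_dom S (bcarr B)"
  shows "bop (relabel_balg c S B) (\<sigma>, map c xs) = c (bop B (\<sigma>, xs))"
proof -
  have "map (inv_into (bcarr B) c) (map c xs) = xs"
    using op_domD[OF xs] inv_into_f_f[OF inj] by (auto simp: subset_iff intro!: map_idI)
  moreover have "(\<sigma>, map c xs) \<in> op_dom S (c ` bcarr B)" by (rule op_dom_map[OF xs subset_refl])
  ultimately show ?thesis by (simp add: relabel_balg_def del: map_map)
qed

lemma ble_relabel_balg:
  assumes inj: "inj_on c (bcarr B)" and sub: "ble B \<subseteq> bcarr B \<times> bcarr B" and xy: "x \<in> bcarr B" "y \<in> bcarr B"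
  shows "(c x, c y) \<in> ble (relabel_balg c S B) \<longleftrightarrow> (x, y) \<in> ble B"
proof
  assume "(c x, c y) \<in> ble (relabel_balg c S B)"
  then obtain x' y' where *: "(x', y') \<in> ble B" "c x = c x'" "c y = c y'"
    by (auto simp: relabel_balg_def)
  then have "x = x'" "y = y'" using sub inj_onD[OF inj] xy by auto
  then show "(x, y) \<in> ble B" using * by simp
qed (auto simp: relabel_balg_def)

lemma
  assumes B: "ordered_algebra S B" and inj: "inj_on c (bcarr B)"
  shows atoms_relabel_balg: "atoms (relabel_balg c S B) = c ` atoms B"
    and at_below_relabel_balg: "x \<in> bcarr B \<Longrightarrow> at_below (relabel_balg c S B) (c x) = c ` at_below B x"
proof -
  have sub: "ble B \<subseteq> bcarr B \<times> bcarr B" using B by (simp add: ordered_algebra_def)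
  have bij: "bij_betw c (carrier (ord_of B)) (carrier (ord_of (relabel_balg c S B)))"
    using inj by (simp add: bij_betw_def)
  have le: "c x \<sqsubseteq>\<^bsub>ord_of (relabel_balg c S B)\<^esub> c y \<longleftrightarrow> x \<sqsubseteq>\<^bsub>ord_of B\<^esub> y"
    if "x \<in> carrier (ord_of B)" "y \<in> carrier (ord_of B)" for x y
    using ble_relabel_balg[OF inj sub] that by simp
  show "atoms (relabel_balg c S B) = c ` atoms B"
    by (rule order_iso_minimals[OF bij le])
  show "at_below (relabel_balg c S B) (c x) = c ` at_below B x" if "x \<in> bcarr B"
    using order_iso_atoms_below[OF bij le] that by simp
qed

text \<open>By \<open>ordered_algebra_iff\<close> the conditions concern atom sets, which
  \<open>c\<close> carries to their images. Images respect unions and products, and injectivity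
  makes them reflect inclusion.\<close>

lemma ordered_algebra_relabel_balg:
  assumes B: "ordered_algebra S B" and inj: "inj_on c (bcarr B)"
  shows "ordered_algebra S (relabel_balg c S B)"
proof -
  let ?R = "relabel_balg c S B"
  interpret powerset_order "ord_of B" by (rule ordered_algebra_order[OF B])
  have sub: "ble B \<subseteq> bcarr B \<times> bcarr B" using B by (simp add: ordered_algebra_def)
  note ble = ble_relabel_balg[OF inj sub] and at = at_below_relabel_balg[OF B inj]
  \<comment> \<open>Every argument tuple is a relabelled tuple, which lets
    \<open>bop_relabel_balg\<close> eliminate \<open>inv_into\<close>.\<close>
  have lift: "\<exists>xs. (\<sigma>, xs) \<in> op_dom S (bcarr B) \<and> ys = map c xs"
    if "(\<sigma>, ys) \<in> op_dom S (c ` bcarr B)" for \<sigma> ys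
  proof -
    have "ys \<in> lists (c ` bcarr B)" using op_domD[OF that] by auto
    then obtain xs where "xs \<in> lists (bcarr B)" "ys = map c xs" unfolding lists_image by auto
    then show ?thesis using op_domD[OF that] by (auto simp: op_dom_def)
  qed
  have po: "powerset_order (ord_of ?R)"
  proof unfold_locales
    fix x y z
    assume "x \<in> carrier (ord_of ?R)" "y \<in> carrier (ord_of ?R)" "z \<in> carrier (ord_of ?R)"
      "x \<sqsubseteq>\<^bsub>ord_of ?R\<^esub> y" "y \<sqsubseteq>\<^bsub>ord_of ?R\<^esub> z"
    then show "x \<sqsubseteq>\<^bsub>ord_of ?R\<^esub> z" using ble le_trans by auto
  next
    fix x y
    assume "x \<sqsubseteq>\<^bsub>ord_of ?R\<^esub> y" "y \<sqsubseteq>\<^bsub>ord_of ?R\<^esub> x"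
      "x \<in> carrier (ord_of ?R)" "y \<in> carrier (ord_of ?R)"
    then show "x .=\<^bsub>ord_of ?R\<^esub> y" using ble by (auto intro!: arg_cong[of _ _ c] le_antisym)
  next
    fix x assume "x \<in> carrier (ord_of ?R)"
    then show "x \<sqsubseteq>\<^bsub>ord_of ?R\<^esub> x" using ble le_refl by auto
  next
    show "atoms ?R \<noteq> {}" using minimals_nonempty by (simp add: atoms_relabel_balg[OF B inj])
  next
    have "at_below ?R ` c ` bcarr B = (`) c ` at_below B ` bcarr B"
      unfolding image_image by (rule image_cong[OF HOL.refl at])
    also have "\<dots> = (`) c ` Pow_ne (atoms B)" using atoms_below_image by simp
    also have "\<dots> = Pow_ne (atoms ?R)"
      unfolding Pow_ne_def atoms_relabel_balg[OF B inj] image_Pow_surj[OF HOL.refl, symmetric] by auto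
    finally show "at_below ?R ` carrier (ord_of ?R) = Pow_ne (atoms ?R)" by simp
  next
    fix x y assume "x \<in> carrier (ord_of ?R)" "y \<in> carrier (ord_of ?R)"
    then obtain x' y' where *: "x = c x'" "y = c y'" "x' \<in> bcarr B" "y' \<in> bcarr B" by auto
    have "c a \<in> c ` at_below B y' \<longleftrightarrow> a \<in> at_below B y'" if "a \<in> at_below B x'" for a
      using that at_below_subset_bcarr[of B x']
      by (intro inj_on_image_mem_iff[OF inj _ at_below_subset_bcarr]) auto
    then have "c ` at_below B x' \<subseteq> c ` at_below B y' \<longleftrightarrow> at_below B x' \<subseteq> at_below B y'"
      unfolding image_subset_iff subset_eq[of "at_below B x'"] by simp
    then have "at_below ?R x \<subseteq> at_below ?R y \<longleftrightarrow> at_below B x' \<subseteq> at_below B y'"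
      using * at by simp
    then show "x \<sqsubseteq>\<^bsub>ord_of ?R\<^esub> y \<longleftrightarrow> at_below ?R x \<subseteq> at_below ?R y"
      using le_iff[of x' y'] * ble by simp
  qed auto
  show ?thesis
    unfolding ordered_algebra_iff
  proof (intro conjI allI impI po)
    show "bop ?R \<in> op_dom S (bcarr ?R) \<rightarrow>\<^sub>E bcarr ?R"
    proof (rule PiE_I)
      fix p assume "p \<in> op_dom S (bcarr ?R)"
      then obtain \<sigma> xs where "(\<sigma>, xs) \<in> op_dom S (bcarr B)" "p = (\<sigma>, map c xs)"
        using lift by (cases p) auto
      then show "bop ?R p \<in> bcarr ?R" using bop_relabel_balg[OF inj] ordered_algebra_bop[OF B] by simp
    qed (simp add: relabel_balg_def)
    show "ble ?R \<subseteq> bcarr ?R \<times> bcarr ?R" using sub by (auto simp: relabel_balg_def)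
    fix \<sigma> ys assume "(\<sigma>, ys) \<in> op_dom S (bcarr ?R)"
    then obtain xs where xs: "(\<sigma>, xs) \<in> op_dom S (bcarr B)" and ys: "ys = map c xs"
      using lift by auto
    have "map (at_below ?R) ys = map ((`) c) (map (at_below B) xs)"
      using op_domD[OF xs] at by (auto simp: ys)
    then have l: "listset (map (at_below ?R) ys) = map c ` listset (map (at_below B) xs)"
      by (simp only: listset_map_image)
    have ata: "at_below ?R (bop ?R (\<sigma>, map c zs)) = c ` at_below B (bop B (\<sigma>, zs))"
      if "(\<sigma>, zs) \<in> op_dom S (bcarr B)" for zs
      unfolding bop_relabel_balg[OF inj that] by (rule at[OF ordered_algebra_bop[OF B that]])
    have "(\<sigma>, zs) \<in> op_dom S (bcarr B)" if "zs \<in> listset (map (at_below B) xs)" for zs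
      by (rule op_dom_listset[OF xs that]) (rule at_below_subset_bcarr)
    note ata' = ata[OF this]
    show "at_below ?R (bop ?R (\<sigma>, ys)) = (\<Union>zs\<in>listset (map (at_below ?R) ys). at_below ?R (bop ?R (\<sigma>, zs)))"
      unfolding l unfolding ys ata[OF xs] ordered_algebra_atoms[OF B xs]
      by (simp add: ata' image_UN)
  qed
qed

lemma balg_iso_relabel:
  assumes B: "ordered_algebra S B" and inj: "inj_on c (bcarr B)"
  shows "balg_iso S B (relabel_balg c S B) (restrict c (bcarr B))"
proof (rule balg_isoI[OF B ordered_algebra_relabel_balg[OF B inj]])
  have sub: "ble B \<subseteq> bcarr B \<times> bcarr B" using B by (simp add: ordered_algebra_def)
  show "bij_betw (restrict c (bcarr B)) (bcarr B) (bcarr (relabel_balg c S B))"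
    using inj by (simp add: bij_betw_def)
  show "(restrict c (bcarr B) x, restrict c (bcarr B) y) \<in> ble (relabel_balg c S B) \<longleftrightarrow> (x, y) \<in> ble B"
    if "x \<in> bcarr B" "y \<in> bcarr B" for x y
    using ble_relabel_balg[OF inj sub that] that by simp
  show "bop (relabel_balg c S B) (\<sigma>, map (restrict c (bcarr B)) xs) = restrict c (bcarr B) (bop B (\<sigma>, xs))"
    if "(\<sigma>, xs) \<in> op_dom S (bcarr B)" for \<sigma> xs
    using bop_relabel_balg[OF inj that] op_domD[OF that] ordered_algebra_bop[OF B that]
    by (simp add: map_restrict)
qed simp

section \<open>The equivalence\<close>

lemma relabel_ftor_simps [simp]:
  "fobj (relabel_ftor c S) = relabel_balg c S"
  "farr (relabel_ftor c S) A B h = (\<lambda>y\<in>c ` bcarr A. c (h (inv_into (bcarr A) c y)))"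
  by (simp_all add: relabel_ftor_def)

text \<open>The map is the conjugate of \<open>h\<close> by the relabelling, hence a composite of
  three homomorphisms.\<close>

lemma relabel_ftor_hom:
  assumes A: "ordered_algebra S A" and injA: "inj_on c (bcarr A)"
    and B: "ordered_algebra S B" and injB: "inj_on c (bcarr B)" and h: "h \<in> balg_hom S A B"
  shows "farr (relabel_ftor c S) A B h \<in> balg_hom S (relabel_balg c S A) (relabel_balg c S B)"
proof -
  let ?RA = "relabel_balg c S A" and ?RB = "relabel_balg c S B"
  note RA = ordered_algebra_relabel_balg[OF A injA] and RB = ordered_algebra_relabel_balg[OF B injB]
  obtain g where g: "g \<in> balg_hom S ?RA A"
    and gc: "compose (bcarr A) g (restrict c (bcarr A)) = (\<lambda>x\<in>bcarr A. x)"
    using balg_iso_relabel[OF A injA] unfolding balg_iso_def by blast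
  have gy: "g (c x) = x" if "x \<in> bcarr A" for x
    using fun_cong[OF gc, of x] that by (simp add: compose_def)
  have cB: "restrict c (bcarr B) \<in> balg_hom S B ?RB"
    using balg_iso_relabel[OF B injB] unfolding balg_iso_def by blast
  have hB: "h x \<in> bcarr B" if "x \<in> bcarr A" for x using balg_hom_PiE[OF h] that by auto
  \<comment> \<open>On relabelled elements \<open>g\<close> and \<open>inv_into\<close> agree;
    elsewhere both sides are undefined.\<close>
  have "farr (relabel_ftor c S) A B h = compose (bcarr ?RA) (restrict c (bcarr B)) (compose (bcarr ?RA) h g)"
    using gy hB inv_into_f_f[OF injA] by (auto simp: fun_eq_iff compose_def)
  also have "\<dots> \<in> balg_hom S ?RA ?RB"
    by (rule balg_hom_compose[OF RA B RB balg_hom_compose[OF RA A B g h] cB])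
  finally show ?thesis .
qed

text \<open>The source is cut down to algebras on which \<open>c\<close> is injective: elsewhere
  \<open>inv_into\<close> need not undo \<open>c\<close>, and identities and composites need not be
  preserved.\<close>

lemma is_functor_relabel_ftor:
  fixes S :: "nat \<Rightarrow> 's set" and c :: "'a \<Rightarrow> 'b"
  shows "is_functor (full_subcategory (AlgB S) {B. inj_on c (bcarr B)}) (AlgB S) (relabel_ftor c S)"
  unfolding is_functor_def
proof (intro conjI ballI category_full_subcategory category_AlgB)
  fix A :: "('s, 'a) balg" assume "A \<in> Obj (full_subcategory (AlgB S) {B. inj_on c (bcarr B)})"
  then show "fobj (relabel_ftor c S) A \<in> Obj (AlgB S)" by (simp add: ordered_algebra_relabel_balg)
next
  fix A B :: "('s, 'a) balg" and h
  assume "A \<in> Obj (full_subcategory (AlgB S) {B. inj_on c (bcarr B)})"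
    "B \<in> Obj (full_subcategory (AlgB S) {B. inj_on c (bcarr B)})"
    "h \<in> Hom (full_subcategory (AlgB S) {B. inj_on c (bcarr B)}) A B"
  then show "farr (relabel_ftor c S) A B h \<in> Hom (AlgB S) (fobj (relabel_ftor c S) A) (fobj (relabel_ftor c S) B)"
    using relabel_ftor_hom[of S A c B h] by simp
next
  fix A :: "('s, 'a) balg" assume "A \<in> Obj (full_subcategory (AlgB S) {B. inj_on c (bcarr B)})"
  then have "inj_on c (bcarr A)" by simp
  then show "farr (relabel_ftor c S) A A (Ident (full_subcategory (AlgB S) {B. inj_on c (bcarr B)}) A) =
      Ident (AlgB S) (fobj (relabel_ftor c S) A)"
    by (auto simp: fun_eq_iff inv_into_f_f)
next
  fix A B C :: "('s, 'a) balg" and f g :: "'a \<Rightarrow> 'a"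
  assume "A \<in> Obj (full_subcategory (AlgB S) {B. inj_on c (bcarr B)})"
    "B \<in> Obj (full_subcategory (AlgB S) {B. inj_on c (bcarr B)})"
    and f: "f \<in> Hom (full_subcategory (AlgB S) {B. inj_on c (bcarr B)}) A B"
  then have inj: "inj_on c (bcarr A)" "inj_on c (bcarr B)" by simp_all
  have fB: "f x \<in> bcarr B" if "x \<in> bcarr A" for x
    using f that balg_hom_PiE[of f S A B] by auto
  show "farr (relabel_ftor c S) A C (Comp (full_subcategory (AlgB S) {B. inj_on c (bcarr B)}) A B C g f) =
      Comp (AlgB S) (fobj (relabel_ftor c S) A) (fobj (relabel_ftor c S) B) (fobj (relabel_ftor c S) C)
        (farr (relabel_ftor c S) B C g) (farr (relabel_ftor c S) A B f)"
    using fB inj by (auto simp: fun_eq_iff compose_def inv_into_f_f)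
qed

text \<open>Subsets of a small set are small, and \<open>code\<close> separates small sets. This
  makes \<open>code\<close> an admissible relabelling of the powerset algebra.\<close>

lemma small_universe_inj_on:
  assumes "small_universe small code" "small A"
  shows "inj_on code (Pow_ne A)"
proof (rule inj_on_subset)
  show "inj_on code {X. small X}" using assms by (simp add: small_universe_def)
  show "Pow_ne A \<subseteq> {X. small X}"
    using assms subset_imp_lepoll[of _ A] unfolding small_universe_def Pow_ne_def by blast
qed

lemma small_universe_image:
  assumes "small_universe small code" "small A"
  shows "small (f ` A)"
  using assms image_lepoll by (auto simp: small_universe_def)

lemma is_functor_coded_P_ftor:
  fixes S :: "nat \<Rightarrow> 's set" and code :: "'u set \<Rightarrow> 'u"
  assumes U: "small_universe small code"
  shows "is_functor (small_MAlg small S) (small_AlgB small S) (coded_P_ftor code S)"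
proof -
  \<comment> \<open>Relabelling is functorial on \<open>?J\<close>, and \<open>?K\<close> ensures
    that the relabelled algebra has a small set of atoms. Powersets of small multialgebras lie in
    both.\<close>
  let ?J = "{B :: ('s, 'u set) balg. inj_on code (bcarr B)}"
  let ?K = "{B :: ('s, 'u set) balg. small (code ` atoms B)}"
  have 1: "is_functor (small_MAlg small S) (full_subcategory (AlgB S) (?J \<inter> ?K)) (P_ftor S)"
    unfolding small_MAlg_def
  proof (rule is_functor_full_subcategory[OF is_functor_P_ftor])
    fix M :: "('s, 'u) malg" assume "M \<in> {M. small (mcarr M)}"
    then show "fobj (P_ftor S) M \<in> ?J \<inter> ?K"
      using small_universe_inj_on[OF U] small_universe_image[OF U]
      by (simp add: atoms_P_alg image_image)
  qed
  have "is_functor (full_subcategory (full_subcategory (AlgB S) ?J) ?K) (small_AlgB small S) (relabel_ftor code S)"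
    unfolding small_AlgB_def
    by (rule is_functor_full_subcategory[OF is_functor_relabel_ftor]) (simp add: atoms_relabel_balg)
  moreover have "full_subcategory (full_subcategory (AlgB S) ?J) ?K = full_subcategory (AlgB S) (?J \<inter> ?K)"
    by (simp add: full_subcategory_def Int_assoc)
  ultimately show ?thesis
    unfolding coded_P_ftor_def using is_functor_comp[OF 1] by simp
qed

lemma is_functor_small_A_ftor:
  "is_functor (small_AlgB small S) (small_MAlg small S) (A_ftor S)"
  unfolding small_AlgB_def small_MAlg_def
  by (rule is_functor_full_subcategory[OF is_functor_A_ftor]) simp

section \<open>Natural isomorphisms across types\<close>

lemma malg_naturally_iso_to_id_A_P:
  fixes S :: "nat \<Rightarrow> 's set"
  shows "malg_naturally_iso_to_id S
    (A_ftor S \<circ>\<^sub>F P_ftor S :: (('s, 'a) malg, 'a \<Rightarrow> 'a, ('s, 'a set) malg, 'a set \<Rightarrow> 'a set) ftor)"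
  unfolding malg_naturally_iso_to_id_def
proof (intro exI[of _ "\<lambda>M. \<lambda>x\<in>mcarr M. {x}"] conjI ballI)
  fix M :: "('s, 'a) malg" assume "M \<in> Obj (MAlg S)"
  then show "malg_iso S M (fobj (A_ftor S \<circ>\<^sub>F P_ftor S) M) (\<lambda>x\<in>mcarr M. {x})"
    by (simp add: comp_ftor_def malg_iso_singleton)
next
  fix M N :: "('s, 'a) malg" and h assume "h \<in> malg_hom S M N"
  from malg_hom_PiE[OF this] have "h x \<in> mcarr N" if "x \<in> mcarr M" for x using that by auto
  then show "compose (mcarr M) (\<lambda>x\<in>mcarr N. {x}) h =
      compose (mcarr M) (farr (A_ftor S \<circ>\<^sub>F P_ftor S) M N h) (\<lambda>x\<in>mcarr M. {x})"
    by (auto simp: comp_ftor_def compose_def fun_eq_iff atoms_P_alg Pow_ne_def)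
qed

text \<open>The square commutes because the atoms below \<open>h x\<close> are the images of the
  atoms below \<open>x\<close>.\<close>

lemma balg_naturally_iso_to_id_P_A:
  fixes S :: "nat \<Rightarrow> 's set"
  shows "balg_naturally_iso_to_id S
    (P_ftor S \<circ>\<^sub>F A_ftor S :: (('s, 'a) balg, 'a \<Rightarrow> 'a, ('s, 'a set) balg, 'a set \<Rightarrow> 'a set) ftor)"
  unfolding balg_naturally_iso_to_id_def
proof (intro exI[of _ "\<lambda>B. restrict (at_below B) (bcarr B)"] conjI ballI)
  fix B :: "('s, 'a) balg" assume "B \<in> Obj (AlgB S)"
  then show "balg_iso S B (fobj (P_ftor S \<circ>\<^sub>F A_ftor S) B) (restrict (at_below B) (bcarr B))"
    by (simp add: comp_ftor_def balg_iso_at_below)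
next
  fix A B :: "('s, 'a) balg" and h
  assume "A \<in> Obj (AlgB S)" "B \<in> Obj (AlgB S)" and h: "h \<in> balg_hom S A B"
  then have A: "ordered_algebra S A" and B: "ordered_algebra S B" by simp_all
  \<comment> \<open>A name for the restricted map keeps the simplifier from expanding it to a conditional.\<close>
  obtain h' where h': "farr (A_ftor S) A B h = h'" by simp
  have im: "h' ` at_below A x = h ` at_below A x" for x
    using image_restrict_at_below[of h A x] h' by (simp only: A_ftor_simps)
  have "h x \<in> bcarr B" if "x \<in> bcarr A" for x using balg_hom_PiE[OF h] that by auto
  then show "compose (bcarr A) (restrict (at_below B) (bcarr B)) h =
      compose (bcarr A) (farr (P_ftor S \<circ>\<^sub>F A_ftor S) A B h) (restrict (at_below A) (bcarr A))"
    using balg_hom_atoms[OF A B h] at_below_in_Pow_ne[OF A]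
    by (auto simp: comp_ftor_def compose_def fun_eq_iff h' im simp del: A_ftor_simps(2))
qed

section \<open>Natural isomorphisms inside a universe\<close>

lemma category_small_MAlg: "category (small_MAlg small S)"
  unfolding small_MAlg_def by (intro category_full_subcategory category_MAlg)

lemma category_small_AlgB: "category (small_AlgB small S)"
  unfolding small_AlgB_def by (intro category_full_subcategory category_AlgB)

lemma coded_P_ftor_simps [simp]:
  "fobj (coded_P_ftor code S) M = relabel_balg code S (P_alg S M)"
  "farr (coded_P_ftor code S) M N h =
    (\<lambda>y\<in>code ` Pow_ne (mcarr M). code ((\<lambda>X\<in>Pow_ne (mcarr M). h ` X) (inv_into (Pow_ne (mcarr M)) code y)))"
  by (simp_all add: coded_P_ftor_def comp_ftor_def)

text \<open>The component is the singleton map into a multialgebra over \<open>'u set\<close>,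
  followed by what the relabelling induces on atoms. Since \<open>code\<close> returns to
  \<open>'u\<close>, the composite is an arrow of the category.\<close>

lemma naturally_isomorphic_id_A_coded_P:
  fixes S :: "nat \<Rightarrow> 's set" and code :: "'u set \<Rightarrow> 'u"
  assumes U: "small_universe small code"
  shows "naturally_isomorphic (small_MAlg small S) (small_MAlg small S) id_ftor (A_ftor S \<circ>\<^sub>F coded_P_ftor code S)"
  unfolding naturally_isomorphic_def
proof (intro conjI exI[of _ "\<lambda>M. \<lambda>x\<in>mcarr M. code {x}"] ballI)
  show "is_functor (small_MAlg small S) (small_MAlg small S) id_ftor"
    by (rule is_functor_id[OF category_small_MAlg])
  show "is_functor (small_MAlg small S) (small_MAlg small S) (A_ftor S \<circ>\<^sub>F coded_P_ftor code S)"
    by (rule is_functor_comp[OF is_functor_coded_P_ftor[OF U] is_functor_small_A_ftor])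
next
  fix M :: "('s, 'u) malg" assume "M \<in> Obj (small_MAlg small S)"
  then have M: "multialgebra S M" and sm: "small (mcarr M)" by (simp_all add: small_MAlg_def)
  have inj: "inj_on code (bcarr (P_alg S M))" using small_universe_inj_on[OF U sm] by simp
  note P = ordered_algebra_P_alg[OF M]
  note R = ordered_algebra_relabel_balg[OF P inj]
  have iso: "malg_iso S M (A_malg S (relabel_balg code S (P_alg S M)))
      (compose (mcarr M) (restrict (restrict code (bcarr (P_alg S M))) (atoms (P_alg S M))) (\<lambda>x\<in>mcarr M. {x}))"
    by (rule malg_iso_compose[OF M multialgebra_A_malg[OF R] malg_iso_singleton[OF M]
          A_ftor_iso[OF P R balg_iso_relabel[OF P inj]]])
  have eq: "compose (mcarr M) (restrict (restrict code (bcarr (P_alg S M))) (atoms (P_alg S M))) (\<lambda>x\<in>mcarr M. {x}) =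
      (\<lambda>x\<in>mcarr M. code {x})"
    by (auto simp: compose_def fun_eq_iff atoms_P_alg Pow_ne_def)
  show "iso_in (small_MAlg small S) (fobj id_ftor M) (fobj (A_ftor S \<circ>\<^sub>F coded_P_ftor code S) M)
      (\<lambda>x\<in>mcarr M. code {x})"
    using iso unfolding eq by (simp add: malg_iso_def iso_in_def small_MAlg_def id_ftor_def comp_ftor_def)
next
  fix M N :: "('s, 'u) malg" and h
  assume M: "M \<in> Obj (small_MAlg small S)" and h: "h \<in> Hom (small_MAlg small S) M N"
  have P: "ordered_algebra S (P_alg S M)" and inj: "inj_on code (Pow_ne (mcarr M))"
    using M small_universe_inj_on[OF U] ordered_algebra_P_alg[of S M] by (simp_all add: small_MAlg_def)
  have at: "atoms (relabel_balg code S (P_alg S M)) = (\<lambda>x. code {x}) ` mcarr M"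
    using atoms_relabel_balg[OF P, of code] inj by (simp add: atoms_P_alg image_image)
  have hN: "h x \<in> mcarr N" if "x \<in> mcarr M" for x
    using h that malg_hom_PiE[of h S M N] by (auto simp: small_MAlg_def)
  have s: "{x} \<in> Pow_ne (mcarr M)" if "x \<in> mcarr M" for x using that by (simp add: Pow_ne_def)
  show "Comp (small_MAlg small S) (fobj id_ftor M) (fobj id_ftor N) (fobj (A_ftor S \<circ>\<^sub>F coded_P_ftor code S) N)
        (\<lambda>x\<in>mcarr N. code {x}) (farr id_ftor M N h) =
      Comp (small_MAlg small S) (fobj id_ftor M) (fobj (A_ftor S \<circ>\<^sub>F coded_P_ftor code S) M)
        (fobj (A_ftor S \<circ>\<^sub>F coded_P_ftor code S) N)
        (farr (A_ftor S \<circ>\<^sub>F coded_P_ftor code S) M N h) (\<lambda>x\<in>mcarr M. code {x})"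
    \<comment> \<open>As \<open>inv_into\<close> undoes \<open>code\<close> on singletons, both
      sides send \<open>x\<close> to \<open>code {h x}\<close>.\<close>
    using hN s inv_into_f_f[OF inj s]
    by (auto simp: small_MAlg_def id_ftor_def comp_ftor_def compose_def fun_eq_iff at)
qed

lemma naturally_isomorphic_id_coded_P_A:
  fixes S :: "nat \<Rightarrow> 's set" and code :: "'u set \<Rightarrow> 'u"
  assumes U: "small_universe small code"
  shows "naturally_isomorphic (small_AlgB small S) (small_AlgB small S) id_ftor (coded_P_ftor code S \<circ>\<^sub>F A_ftor S)"
  unfolding naturally_isomorphic_def
proof (intro conjI exI[of _ "\<lambda>B. \<lambda>x\<in>bcarr B. code (at_below B x)"] ballI)
  show "is_functor (small_AlgB small S) (small_AlgB small S) id_ftor"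
    by (rule is_functor_id[OF category_small_AlgB])
  show "is_functor (small_AlgB small S) (small_AlgB small S) (coded_P_ftor code S \<circ>\<^sub>F A_ftor S)"
    by (rule is_functor_comp[OF is_functor_small_A_ftor is_functor_coded_P_ftor[OF U]])
next
  fix B :: "('s, 'u) balg" assume "B \<in> Obj (small_AlgB small S)"
  then have B: "ordered_algebra S B" and sm: "small (atoms B)" by (simp_all add: small_AlgB_def)
  let ?P = "P_alg S (A_malg S B)"
  \<comment> \<open>Smallness bounds only the atoms of \<open>B\<close>, which suffices because the
    sets to be coded are sets of atoms.\<close>
  have inj: "inj_on code (bcarr ?P)" using small_universe_inj_on[OF U sm] by simp
  note P = ordered_algebra_P_alg[OF multialgebra_A_malg[OF B]]
  note R = ordered_algebra_relabel_balg[OF P inj]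
  have iso: "balg_iso S B (relabel_balg code S ?P)
      (compose (bcarr B) (restrict code (bcarr ?P)) (restrict (at_below B) (bcarr B)))"
    by (rule balg_iso_compose[OF B P R balg_iso_at_below[OF B] balg_iso_relabel[OF P inj]])
  have eq: "compose (bcarr B) (restrict code (bcarr ?P)) (restrict (at_below B) (bcarr B)) =
      (\<lambda>x\<in>bcarr B. code (at_below B x))"
    using at_below_in_Pow_ne[OF B] by (auto simp: compose_def fun_eq_iff)
  show "iso_in (small_AlgB small S) (fobj id_ftor B) (fobj (coded_P_ftor code S \<circ>\<^sub>F A_ftor S) B)
      (\<lambda>x\<in>bcarr B. code (at_below B x))"
    using iso unfolding eq by (simp add: balg_iso_def iso_in_def small_AlgB_def id_ftor_def comp_ftor_def)
next
  fix A B :: "('s, 'u) balg" and h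
  assume "A \<in> Obj (small_AlgB small S)" "B \<in> Obj (small_AlgB small S)" "h \<in> Hom (small_AlgB small S) A B"
  then have A: "ordered_algebra S A" and B: "ordered_algebra S B" and h: "h \<in> balg_hom S A B"
    and sm: "small (atoms A)" by (simp_all add: small_AlgB_def)
  note inj = small_universe_inj_on[OF U sm]
  have hB: "h x \<in> bcarr B" if "x \<in> bcarr A" for x using balg_hom_PiE[OF h] that by auto
  note at = at_below_in_Pow_ne[OF A]
  obtain h' where h': "farr (A_ftor S) A B h = h'" by simp
  have im: "h' ` at_below A x = h ` at_below A x" for x
    using image_restrict_at_below[of h A x] h' by (simp only: A_ftor_simps)
  show "Comp (small_AlgB small S) (fobj id_ftor A) (fobj id_ftor B) (fobj (coded_P_ftor code S \<circ>\<^sub>F A_ftor S) B)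
        (\<lambda>x\<in>bcarr B. code (at_below B x)) (farr id_ftor A B h) =
      Comp (small_AlgB small S) (fobj id_ftor A) (fobj (coded_P_ftor code S \<circ>\<^sub>F A_ftor S) A)
        (fobj (coded_P_ftor code S \<circ>\<^sub>F A_ftor S) B)
        (farr (coded_P_ftor code S \<circ>\<^sub>F A_ftor S) A B h) (\<lambda>x\<in>bcarr A. code (at_below A x))"
    \<comment> \<open>Both sides send \<open>x\<close> to the code of the image under
      \<open>h\<close> of the atoms below \<open>x\<close>.\<close>
    using hB at inv_into_f_f[OF inj at] balg_hom_atoms[OF A B h]
    by (auto simp: small_AlgB_def id_ftor_def comp_ftor_def compose_def fun_eq_iff h' im
        simp del: A_ftor_simps(2))
qed

theorem mainTheorem1:
  fixes S :: "nat \<Rightarrow> 's set"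
  assumes "signature S"
  shows
    "is_functor (MAlg S) (AlgB S)
        (P_ftor S :: (('s, 'a) malg, 'a \<Rightarrow> 'a, ('s, 'a set) balg, 'a set \<Rightarrow> 'a set) ftor) \<and>
     is_functor (AlgB S) (MAlg S)
        (A_ftor S :: (('s, 'b) balg, 'b \<Rightarrow> 'b, ('s, 'b) malg, 'b \<Rightarrow> 'b) ftor) \<and>
     malg_naturally_iso_to_id S
        (A_ftor S \<circ>\<^sub>F P_ftor S :: (('s, 'a) malg, 'a \<Rightarrow> 'a, ('s, 'a set) malg, 'a set \<Rightarrow> 'a set) ftor) \<and>
     balg_naturally_iso_to_id S
        (P_ftor S \<circ>\<^sub>F A_ftor S :: (('s, 'b) balg, 'b \<Rightarrow> 'b, ('s, 'b set) balg, 'b set \<Rightarrow> 'b set) ftor) \<and>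
     (\<forall>(small :: 'u set \<Rightarrow> bool) code. small_universe small code \<longrightarrow>
        equivalence_of_categories (small_MAlg small S) (small_AlgB small S)
          (coded_P_ftor code S) (A_ftor S))"
  unfolding equivalence_of_categories_def
  by (intro conjI allI impI is_functor_P_ftor is_functor_A_ftor malg_naturally_iso_to_id_A_P
      balg_naturally_iso_to_id_P_A is_functor_coded_P_ftor is_functor_small_A_ftor
      naturally_isomorphic_id_A_coded_P naturally_isomorphic_id_coded_P_A)

end
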